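(* Let $K\subset\mathbb{R}^n$ be a convex $n$-polytope with $N$ facets. Let $F$ be a $t$-cubature formula on $K$ with uniform measure. If $F$ is positive, interior or positive, boundary, and if $K$ is simple, then $F$ is an $\epsilon$-net with respect to the metric $$ds^2=\frac{dx_1^2}{x_1}+\frac{dx_2^2}{x_2}+\cdots+\frac{dx_N^2}{x_N},$$ where $\epsilon=O(1/t)$. If $F$ is positive, then its least weight is $O(t^{-2n})$. If $F$ is a $t$-design, then it has $\Omega(t^{2n})$ points. (The implied constants depend only on $K$.)
   Context: For $1\le i\le N$, $x_i$ denotes the distance function from the hyperplane containing the $i$th facet of $K$, i.e. an affine-linear function on $\mathbb{R}^n$ that vanishes on the $i$th facet and is positive on the interior of $K$. Distance on $K$ is the path distance of $ds^2$, extended to the boundary. $F$ is an $\epsilon$-net if every point of $K$ is within distance $\epsilon$ of some point of $F$. A polytope is simple if each vertex lies on exactly $n$ facets. $K$ carries normalized uniform measure $\mu$. A $t$-cubature formula on $K$ is a finite set of points $F=\{p_a\}\subset\mathbb{R}^n$ with real weights $w_a$ such that $\int_KP\,d\mu=\sum_aw_aP(p_a)$ for all polynomials $P$ of degree at most $t$; it is positive if all $w_a>0$, interior if all points lie in the interior of $K$, and boundary if all points lie in $K$ and some lie on $\partial K$. A $t$-design is a $t$-cubature formula with all weights equal and all points in $K$. *)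

theory Defs
  imports "HOL-Analysis.Analysis"
begin

definition poly_degree_le :: "nat \<Rightarrow> (real ^ 'n \<Rightarrow> real) \<Rightarrow> bool" where
  "poly_degree_le t P \<longleftrightarrow>
     (\<exists>c :: ('n \<Rightarrow> nat) \<Rightarrow> real.
        P = (\<lambda>x. \<Sum>\<alpha> | (\<Sum>i\<in>UNIV. \<alpha> i) \<le> t. c \<alpha> * (\<Prod>i\<in>UNIV. (x $ i) ^ \<alpha> i)))"

lemma finite_exponents: "finite {\<alpha> :: 'n::finite \<Rightarrow> nat. (\<Sum>i\<in>UNIV. \<alpha> i) \<le> t}"
proof (rule finite_subset)
  have "\<alpha> i \<le> (\<Sum>j\<in>UNIV. \<alpha> j)" for \<alpha> :: "'n \<Rightarrow> nat" and i
    by (rule member_le_sum) simp_all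
  then show "{\<alpha> :: 'n \<Rightarrow> nat. (\<Sum>i\<in>UNIV. \<alpha> i) \<le> t} \<subseteq> PiE UNIV (\<lambda>_. {..t})"
    unfolding PiE_UNIV_domain by (blast intro: le_trans)
  show "finite (PiE (UNIV :: 'n set) (\<lambda>_. {..t}))"
    by (rule finite_PiE) simp_all
qed

definition cubature_formula ::
  "(real ^ 'n) set \<Rightarrow> nat \<Rightarrow> (real ^ 'n) set \<Rightarrow> (real ^ 'n \<Rightarrow> real) \<Rightarrow> bool" where
  "cubature_formula K t F w \<longleftrightarrow>
     finite F \<and>
     (\<forall>P. poly_degree_le t P \<longrightarrow>
        integral\<^sup>L (uniform_measure lborel K) P = (\<Sum>p\<in>F. w p * P p))"

definition positive_formula :: "(real ^ 'n) set \<Rightarrow> (real ^ 'n \<Rightarrow> real) \<Rightarrow> bool" where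
  "positive_formula F w \<longleftrightarrow> (\<forall>p\<in>F. w p > 0)"

definition interior_formula :: "(real ^ 'n) set \<Rightarrow> (real ^ 'n) set \<Rightarrow> bool" where
  "interior_formula K F \<longleftrightarrow> F \<subseteq> interior K"

definition boundary_formula :: "(real ^ 'n) set \<Rightarrow> (real ^ 'n) set \<Rightarrow> bool" where
  "boundary_formula K F \<longleftrightarrow> F \<subseteq> K \<and> F \<inter> frontier K \<noteq> {}"

definition design ::
  "(real ^ 'n) set \<Rightarrow> nat \<Rightarrow> (real ^ 'n) set \<Rightarrow> (real ^ 'n \<Rightarrow> real) \<Rightarrow> bool" where
  "design K t F w \<longleftrightarrow>
     cubature_formula K t F w \<and> (\<forall>p\<in>F. \<forall>q\<in>F. w p = w q) \<and> F \<subseteq> K"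

definition simple_polytope :: "(real ^ 'n) set \<Rightarrow> bool" where
  "simple_polytope K \<longleftrightarrow>
     (\<forall>v. v extreme_point_of K \<longrightarrow> card {f. f facet_of K \<and> v \<in> f} = CARD('n))"

text \<open>The coordinates are indexed by the facets themselves. The scale of each of them is left
  free; the Euclidean distance to the hyperplane of the facet is one choice.\<close>

definition facet_functions ::
  "(real ^ 'n) set \<Rightarrow> ((real ^ 'n) set \<Rightarrow> real ^ 'n \<Rightarrow> real) \<Rightarrow> bool" where
  "facet_functions K x \<longleftrightarrow>
     (\<forall>f. f facet_of K \<longrightarrow>
        (\<exists>a b. \<forall>p. x f p = a \<bullet> p + b) \<and>
        (\<forall>p\<in>f. x f p = 0) \<and>
        (\<forall>p\<in>interior K. x f p > 0))"

definition line_element ::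
  "(real ^ 'n) set \<Rightarrow> ((real ^ 'n) set \<Rightarrow> real ^ 'n \<Rightarrow> real) \<Rightarrow> real ^ 'n \<Rightarrow> real ^ 'n \<Rightarrow> real" where
  "line_element K x p v =
     sqrt (\<Sum>f | f facet_of K. (frechet_derivative (x f) (at p) v)\<^sup>2 / x f p)"

text \<open>The length is demanded as a \<open>has_integral\<close> value: \<open>valid_path\<close> admits paths
  of infinite length, to which \<open>integral\<close> would assign the length 0.\<close>

definition interior_path_dist ::
  "(real ^ 'n) set \<Rightarrow> ((real ^ 'n) set \<Rightarrow> real ^ 'n \<Rightarrow> real) \<Rightarrow> real ^ 'n \<Rightarrow> real ^ 'n \<Rightarrow> real" where
  "interior_path_dist K x p q =
     Inf {L. \<exists>\<gamma>. valid_path \<gamma> \<and> pathstart \<gamma> = p \<and> pathfinish \<gamma> = q \<and>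
                 path_image \<gamma> \<subseteq> interior K \<and>
                 ((\<lambda>s. line_element K x (\<gamma> s) (vector_derivative \<gamma> (at s))) has_integral L) {0..1}}"

text \<open>Continuous extension of the distance from the interior of \<open>K\<close> to \<open>K\<close>.\<close>

definition path_dist ::
  "(real ^ 'n) set \<Rightarrow> ((real ^ 'n) set \<Rightarrow> real ^ 'n \<Rightarrow> real) \<Rightarrow> real ^ 'n \<Rightarrow> real ^ 'n \<Rightarrow> real" where
  "path_dist K x p q =
     Lim (at (p, q) within interior K \<times> interior K) (\<lambda>(p', q'). interior_path_dist K x p' q')"

definition epsilon_net ::
  "(real ^ 'n) set \<Rightarrow> ((real ^ 'n) set \<Rightarrow> real ^ 'n \<Rightarrow> real) \<Rightarrow> real \<Rightarrow> (real ^ 'n) set \<Rightarrow> bool" where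
  "epsilon_net K x \<epsilon> F \<longleftrightarrow> (\<forall>q\<in>K. \<exists>p\<in>F. path_dist K x q p \<le> \<epsilon>)"

end

theory Submission
  imports Defs "HOL-Computational_Algebra.Polynomial"
begin

text \<open>
  Put \<open>k = 2j + 1\<close>. The polynomial \<open>sin (k\<theta>) / (k sin \<theta>)\<close> in \<open>s = sin\<^sup>2 \<theta>\<close>, raised to a high even
  power, is a nonnegative bump of degree \<open>O(k)\<close> concentrated on \<open>s = O(1/k\<^sup>2)\<close>. If the bump \<open>G\<close>
  satisfies \<open>\<integral>GQ < R \<integral>G\<close>, a positive formula that integrates \<open>G (R - Q)\<close> exactly must have a node
  with \<open>G > 0\<close> and \<open>Q < R\<close>.

  Weights: evaluate the bump at an affine function \<open>l\<close> that vanishes at a vertex and dominates the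
  distance to it on \<open>K\<close>. This gives a node with \<open>l = O(1/k\<^sup>2)\<close>, possibly outside \<open>K\<close>, where \<open>l < 0\<close>
  is harmless since the bump is large there. A wider bump is bounded below at this node and has
  the integral \<open>O(k\<^sup>-\<^sup>2\<^sup>n)\<close>, which bounds the weight.

  Net: near a given point of a simple polytope, the \<open>n\<close> facet functions \<open>x\<^sub>i\<close> through a suitable vertex
  are affine coordinates and the others are bounded away from 0. In the coordinates \<open>\<surd>x\<^sub>i\<close> the metric is
  flat up to constants, and symmetrising the bump under \<open>\<surd>x\<^sub>i \<mapsto> -\<surd>x\<^sub>i\<close> makes it a polynomial in
  \<open>x\<^sub>i\<close>. The product of these bumps gives a node within \<open>O(1/k)\<close> in every \<open>\<surd>x\<^sub>i\<close>. On a segment every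
  facet function is monotone, so the path distance is at most \<open>2 \<Sum> |\<surd>x\<^sub>f(p) - \<surd>x\<^sub>f(q)|\<close>.
\<close>

section \<open>Bump polynomials\<close>

text \<open>With \<open>s = sin\<^sup>2 x\<close> this is the Dirichlet kernel
  \<open>1 + 2 cos 2x + ... + 2 cos 2jx = sin ((2j+1)x) / sin x\<close>, in other words the
  Chebyshev polynomial of the fourth kind at \<open>1 - 2s\<close>. The factor \<open>2 - 4s\<close>
  of the recurrence is \<open>2 cos 2x\<close>.\<close>

fun dirichlet_poly :: "nat \<Rightarrow> real poly" where
  "dirichlet_poly 0 = 1"
| "dirichlet_poly (Suc 0) = [:3, -4:]"
| "dirichlet_poly (Suc (Suc j)) = [:2, -4:] * dirichlet_poly (Suc j) - dirichlet_poly j"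

lemma degree_dirichlet_poly: "degree (dirichlet_poly j) \<le> j"
proof (induction j rule: dirichlet_poly.induct)
  case (3 j)
  have "degree ([:2, -4:] * dirichlet_poly (Suc j)) \<le> degree [:2, -4::real:] + degree (dirichlet_poly (Suc j))"
    by (rule degree_mult_le)
  also have "\<dots> \<le> Suc (Suc j)"
    using 3 by simp
  finally show ?case
    using 3 by (simp add: degree_diff_le)
qed simp_all

lemma dirichlet_poly_sin:
  "poly (dirichlet_poly j) ((sin x)\<^sup>2) * sin x = sin (real (2 * j + 1) * x)"
proof (induction j rule: dirichlet_poly.induct)
  case 2
  have "sin (3 * x) = sin (2 * x + x)" by (simp add: algebra_simps)
  also have "\<dots> = 2 * sin x * (cos x)\<^sup>2 + (1 - 2 * (sin x)\<^sup>2) * sin x"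
    by (simp only: sin_add sin_double cos_double_sin) (simp add: power2_eq_square)
  also have "\<dots> = (3 - 4 * (sin x)\<^sup>2) * sin x"
    by (simp add: cos_squared_eq algebra_simps)
  finally show ?case by simp
next
  case (3 j)
  define a where "a = real (2 * j + 3) * x"
  have e: "real (2 * Suc (Suc j) + 1) * x = a + 2 * x" "real (2 * Suc j + 1) * x = a"
      "real (2 * j + 1) * x = a - 2 * x"
    by (simp_all add: a_def algebra_simps)
  have "poly (dirichlet_poly (Suc (Suc j))) ((sin x)\<^sup>2) * sin x =
     (2 - 4 * (sin x)\<^sup>2) * (poly (dirichlet_poly (Suc j)) ((sin x)\<^sup>2) * sin x)
       - poly (dirichlet_poly j) ((sin x)\<^sup>2) * sin x"
    by (simp add: algebra_simps)
  also have "\<dots> = 2 * cos (2 * x) * sin a - sin (a - 2 * x)"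
    unfolding 3 e by (simp add: cos_double_sin)
  also have "\<dots> = sin (a + 2 * x)"
    by (simp add: sin_add sin_diff)
  finally show ?case by (simp only: e)
qed simp

lemma abs_sin_mult_le: "\<bar>sin (real k * x)\<bar> \<le> real k * \<bar>sin x\<bar>"
proof (induction k)
  case (Suc k)
  have "\<bar>sin (real (Suc k) * x)\<bar> = \<bar>sin (real k * x) * cos x + cos (real k * x) * sin x\<bar>"
    by (simp add: algebra_simps sin_add)
  also have "\<dots> \<le> \<bar>sin (real k * x)\<bar> * \<bar>cos x\<bar> + \<bar>cos (real k * x)\<bar> * \<bar>sin x\<bar>"
    by (simp add: abs_mult[symmetric] abs_triangle_ineq)
  also have "\<dots> \<le> \<bar>sin (real k * x)\<bar> * 1 + 1 * \<bar>sin x\<bar>"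
    by (intro add_mono mult_mono) auto
  finally show ?case using Suc by (simp add: algebra_simps)
qed simp

lemma sin_squared_surj:
  fixes s :: real
  assumes "0 \<le> s" "s \<le> 1"
  obtains x where "(sin x)\<^sup>2 = s"
proof
  have "sqrt s \<le> 1" "-1 \<le> sqrt s"
    using assms real_sqrt_ge_zero[of s] by (simp, linarith)
  then show "(sin (arcsin (sqrt s)))\<^sup>2 = s"
    using assms by simp
qed

lemma dirichlet_poly_at_0: "poly (dirichlet_poly j) 0 = real (2 * j + 1)"
  by (induction j rule: dirichlet_poly.induct) auto

lemma abs_dirichlet_poly_le:
  assumes "0 \<le> s" "s \<le> 1"
  shows "\<bar>poly (dirichlet_poly j) s\<bar> \<le> real (2 * j + 1)"
\<comment> \<open>At \<open>s = 0\<close> the factor \<open>sin x\<close> vanishes and cannot be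
  cancelled, so the explicit value replaces the identity.\<close>
proof (cases "s = 0")
  case True
  then show ?thesis by (simp add: dirichlet_poly_at_0)
next
  case False
  obtain x where x: "(sin x)\<^sup>2 = s" using sin_squared_surj assms by blast
  with False have "sin x \<noteq> 0" by auto
  moreover have "\<bar>poly (dirichlet_poly j) s\<bar> * \<bar>sin x\<bar> \<le> real (2 * j + 1) * \<bar>sin x\<bar>"
    using abs_sin_mult_le[of "2 * j + 1" x] by (simp only: dirichlet_poly_sin[of j x, unfolded x, symmetric] abs_mult)
  ultimately show ?thesis by (metis mult_le_cancel_right_pos zero_less_abs_iff)
qed

lemma dirichlet_poly_square_le:
  assumes "0 \<le> s" "s \<le> 1"
  shows "s * (poly (dirichlet_poly j) s)\<^sup>2 \<le> 1"
proof -
  obtain x where x: "(sin x)\<^sup>2 = s" using sin_squared_surj assms by blast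
  have "s * (poly (dirichlet_poly j) s)\<^sup>2 = (poly (dirichlet_poly j) s * sin x)\<^sup>2"
    by (simp add: power_mult_distrib x)
  also have "\<dots> = (sin (real (2 * j + 1) * x))\<^sup>2"
    by (simp only: dirichlet_poly_sin[of j x, unfolded x])
  also have "\<dots> \<le> 1" by (simp add: abs_square_le_1)
  finally show ?thesis .
qed

text \<open>The second difference in \<open>j\<close> is \<open>-4s\<close> times the middle term,
  which is nonnegative here, so the increments never fall below 2. This serves nodes outside
  \<open>K\<close>, where the argument of the bump may be negative.\<close>

lemma dirichlet_poly_ge_nonpos:
  assumes "s \<le> 0"
  shows "real (2 * j + 1) \<le> poly (dirichlet_poly j) s"
proof -
  have "real (2 * j + 1) \<le> poly (dirichlet_poly j) s \<and>
        2 \<le> poly (dirichlet_poly (Suc j)) s - poly (dirichlet_poly j) s"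
  proof (induction j)
    case (Suc j)
    have "0 \<le> (- 4 * s) * poly (dirichlet_poly (Suc j)) s"
      using conjunct1[OF Suc.IH] conjunct2[OF Suc.IH] assms by - (rule mult_nonneg_nonneg; linarith)
    then show ?case using Suc by (simp add: algebra_simps)
  qed (use assms in simp)
  then show ?thesis ..
qed

text \<open>The second difference in \<open>j\<close> is at least \<open>-4s (2j + 3)\<close> by
  \<open>abs_dirichlet_poly_le\<close>. Summing once bounds the increments by
  \<open>2 - 4s (j+1)\<^sup>2\<close>; summing again subtracts \<open>4s\<close> times the sum of
  the first \<open>j\<close> squares from \<open>2j + 1\<close>.\<close>

lemma dirichlet_poly_ge:
  assumes "0 \<le> s" "s \<le> 1"
  shows "real (2 * j + 1) * (1 - 2 / 3 * s * real (j * (j + 1))) \<le> poly (dirichlet_poly j) s"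
proof -
  have "real (2 * j + 1) * (1 - 2 / 3 * s * real (j * (j + 1))) \<le> poly (dirichlet_poly j) s \<and>
        2 - 4 * s * (real (j + 1))\<^sup>2 \<le> poly (dirichlet_poly (Suc j)) s - poly (dirichlet_poly j) s"
  proof (induction j)
    case (Suc j)
    have "s * poly (dirichlet_poly (Suc j)) s \<le> s * real (2 * Suc j + 1)"
      using abs_dirichlet_poly_le[OF assms, of "Suc j"] assms by (intro mult_left_mono) linarith+
    moreover note conjunct1[OF Suc.IH] conjunct2[OF Suc.IH]
    ultimately show ?case
      by (intro conjI; simp add: algebra_simps power2_eq_square; simp add: add_divide_distrib)
  qed simp
  then show ?thesis ..
qed

section \<open>Bumps from even powers of the Dirichlet polynomial\<close>

definition bump :: "nat \<Rightarrow> real \<Rightarrow> nat \<Rightarrow> real poly" where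
  "bump m \<Lambda> j = (smult (1 / real (2 * j + 1)) (pcompose (dirichlet_poly j) [:0, 1 / \<Lambda>:])) ^ (2 * m)"

lemma poly_bump: "poly (bump m \<Lambda> j) s = ((poly (dirichlet_poly j) (s / \<Lambda>) / real (2 * j + 1))\<^sup>2) ^ m"
  by (simp add: bump_def poly_pcompose power_mult)

lemma degree_bump: "degree (bump m \<Lambda> j) \<le> 2 * m * j"
proof -
  have "degree (pcompose (dirichlet_poly j) [:0, 1 / \<Lambda>:]) \<le> degree (dirichlet_poly j) * degree [:0, 1 / \<Lambda>:]"
    by (rule degree_pcompose_le)
  also have "\<dots> \<le> j * 1"
    using degree_dirichlet_poly by (intro mult_mono) auto
  finally have "degree (smult (1 / real (2 * j + 1)) (pcompose (dirichlet_poly j) [:0, 1 / \<Lambda>:])) \<le> j"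
    using degree_smult_le order_trans by fastforce
  then have "degree (bump m \<Lambda> j) \<le> j * (2 * m)"
    unfolding bump_def by (meson degree_power_le le_trans mult_le_mono1)
  then show ?thesis by (simp add: mult.commute)
qed

lemma bump_nonneg: "0 \<le> poly (bump m \<Lambda> j) s"
  by (simp add: poly_bump)

text \<open>Adding \<open>w\<^sup>2 \<le> k\<^sup>2\<close> and
  \<open>k\<^sup>2 r w\<^sup>2 \<le> k\<^sup>2\<close> gives decay in \<open>k\<^sup>2 s\<close>
  that stays finite at \<open>s = 0\<close>. Both bounds need the argument in \<open>[0, 1]\<close>,
  hence the rescaling by \<open>\<Lambda>\<close>, which costs a factor
  \<open>\<Lambda>\<close>.\<close>

lemma bump_le:
  assumes "1 \<le> \<Lambda>" "0 \<le> s" "s \<le> \<Lambda>"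
  shows "poly (bump m \<Lambda> j) s \<le> (2 * \<Lambda> / (1 + (real (2 * j + 1))\<^sup>2 * s)) ^ m"
proof -
  define k where "k = real (2 * j + 1)"
  define r where "r = s / \<Lambda>"
  define w where "w = poly (dirichlet_poly j) r"
  have k: "k > 0" by (simp add: k_def)
  have r: "0 \<le> r" "r \<le> 1" using assms by (auto simp: r_def)
  have "w\<^sup>2 \<le> k\<^sup>2"
    using abs_dirichlet_poly_le[OF r, of j] by (simp add: w_def k_def abs_le_square_iff[symmetric])
  moreover have "k\<^sup>2 * (r * w\<^sup>2) \<le> k\<^sup>2 * 1"
    using dirichlet_poly_square_le[OF r] by (intro mult_left_mono) (auto simp: w_def)
  ultimately have 1: "w\<^sup>2 * (1 + k\<^sup>2 * r) \<le> 2 * k\<^sup>2"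
    by (simp add: algebra_simps)
  have "1 + k\<^sup>2 * s \<le> \<Lambda> + k\<^sup>2 * s" using assms by simp
  also have "\<dots> = \<Lambda> * (1 + k\<^sup>2 * r)" using assms by (simp add: r_def field_simps)
  finally have "w\<^sup>2 * (1 + k\<^sup>2 * s) \<le> \<Lambda> * (w\<^sup>2 * (1 + k\<^sup>2 * r))"
    using mult_left_mono[of "1 + k\<^sup>2 * s" "\<Lambda> * (1 + k\<^sup>2 * r)" "w\<^sup>2"] by (simp add: mult.left_commute)
  also have "\<dots> \<le> \<Lambda> * (2 * k\<^sup>2)" using 1 assms by (intro mult_left_mono) auto
  finally have "w\<^sup>2 * (1 + k\<^sup>2 * s) \<le> 2 * \<Lambda> * k\<^sup>2" by simp
  moreover have "0 < 1 + k\<^sup>2 * s" using assms by (simp add: add_pos_nonneg)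
  ultimately have "(w / k)\<^sup>2 \<le> 2 * \<Lambda> / (1 + k\<^sup>2 * s)"
    using k by (simp add: power_divide field_simps)
  then show ?thesis
    unfolding poly_bump k_def[symmetric] r_def[symmetric] w_def[symmetric]
    by (intro power_mono) auto
qed

text \<open>For \<open>0 < r \<le> 1/k\<^sup>2\<close> the relative loss in
  \<open>dirichlet_poly_ge\<close> is at most \<open>1/6\<close>, so the kernel keeps at least half
  of its value \<open>k\<close> at 0; negative arguments only increase it. A larger
  \<open>\<Lambda>\<close> widens the region of this bound without changing the degree
  estimate.\<close>

lemma bump_ge:
  assumes "0 < \<Lambda>" "s \<le> \<Lambda> / (real (2 * j + 1))\<^sup>2"
  shows "(1 / 4) ^ m \<le> poly (bump m \<Lambda> j) s"
proof -
  define k where "k = real (2 * j + 1)"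
  define r where "r = s / \<Lambda>"
  define w where "w = poly (dirichlet_poly j) r"
  have k: "k \<ge> 1" by (simp add: k_def)
  have r: "r \<le> 1 / k\<^sup>2" using assms(1) divide_right_mono[OF assms(2), of \<Lambda>] unfolding r_def k_def by simp
  also have "1 / k\<^sup>2 \<le> 1" using k by simp
  finally have r1: "r \<le> 1" .
  have "k / 2 \<le> w"
  proof (cases "r \<le> 0")
    case True
    then show ?thesis using dirichlet_poly_ge_nonpos[OF True, of j] k by (simp add: w_def k_def)
  next
    case False
    have "real (j * (j + 1)) \<le> k\<^sup>2 / 4"
      by (simp add: k_def power2_eq_square algebra_simps)
    then have "r * real (j * (j + 1)) \<le> (1 / k\<^sup>2) * (k\<^sup>2 / 4)"
      using r False k by (intro mult_mono) auto
    then have "1 / 2 \<le> 1 - 2 / 3 * r * real (j * (j + 1))"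
      using k by simp
    then have "k * (1 / 2) \<le> k * (1 - 2 / 3 * r * real (j * (j + 1)))"
      using k by (intro mult_left_mono) auto
    also have "\<dots> \<le> w"
      unfolding k_def w_def using dirichlet_poly_ge[of r j] False r1 by auto
    finally show ?thesis by simp
  qed
  then have "1 / 2 \<le> w / k" using k by (simp add: field_simps)
  then have "(1 / 2)\<^sup>2 \<le> (w / k)\<^sup>2" by (intro power_mono) auto
  then show ?thesis
    unfolding poly_bump k_def[symmetric] r_def[symmetric] w_def[symmetric]
    by (intro power_mono) (auto simp: power2_eq_square)
qed

section \<open>Polynomials of bounded degree\<close>

lemma poly_degree_le_mono: "poly_degree_le s P" if "poly_degree_le r P" "r \<le> s"
proof -
  obtain c where c: "P = (\<lambda>x. \<Sum>\<alpha> | (\<Sum>i\<in>UNIV. \<alpha> i) \<le> r. c \<alpha> * (\<Prod>i\<in>UNIV. (x $ i) ^ \<alpha> i))"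
    using \<open>poly_degree_le r P\<close> unfolding poly_degree_le_def by blast
  have "P x = (\<Sum>\<alpha> | (\<Sum>i\<in>UNIV. \<alpha> i) \<le> s.
      (if (\<Sum>i\<in>UNIV. \<alpha> i) \<le> r then c \<alpha> else 0) * (\<Prod>i\<in>UNIV. (x $ i) ^ \<alpha> i))" for x
    unfolding c using \<open>r \<le> s\<close> by (intro sum.mono_neutral_cong_left finite_exponents) auto
  then show ?thesis unfolding poly_degree_le_def
    by (intro exI[of _ "\<lambda>\<alpha>. if (\<Sum>i\<in>UNIV. \<alpha> i) \<le> r then c \<alpha> else 0"] ext)
qed

lemma poly_degree_le_add:
  assumes "poly_degree_le t P" "poly_degree_le t Q"
  shows "poly_degree_le t (\<lambda>x. P x + Q x)"
proof -
  obtain c d where "P = (\<lambda>x. \<Sum>\<alpha> | (\<Sum>i\<in>UNIV. \<alpha> i) \<le> t. c \<alpha> * (\<Prod>i\<in>UNIV. (x $ i) ^ \<alpha> i))"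
    "Q = (\<lambda>x. \<Sum>\<alpha> | (\<Sum>i\<in>UNIV. \<alpha> i) \<le> t. d \<alpha> * (\<Prod>i\<in>UNIV. (x $ i) ^ \<alpha> i))"
    using assms unfolding poly_degree_le_def by blast
  then show ?thesis unfolding poly_degree_le_def
    by (intro exI[of _ "\<lambda>\<alpha>. c \<alpha> + d \<alpha>"]) (simp add: distrib_right sum.distrib)
qed

lemma poly_degree_le_cmult:
  assumes "poly_degree_le t P"
  shows "poly_degree_le t (\<lambda>x. a * P x)"
proof -
  obtain c where "P = (\<lambda>x. \<Sum>\<alpha> | (\<Sum>i\<in>UNIV. \<alpha> i) \<le> t. c \<alpha> * (\<Prod>i\<in>UNIV. (x $ i) ^ \<alpha> i))"
    using assms unfolding poly_degree_le_def by blast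
  then show ?thesis unfolding poly_degree_le_def
    by (intro exI[of _ "\<lambda>\<alpha>. a * c \<alpha>"]) (simp add: sum_distrib_left mult.assoc)
qed

lemma poly_degree_le_monomial:
  fixes \<beta> :: "'n::finite \<Rightarrow> nat"
  assumes "(\<Sum>i\<in>UNIV. \<beta> i) \<le> t"
  shows "poly_degree_le t (\<lambda>x. \<Prod>i\<in>UNIV. (x $ i) ^ \<beta> i)"
proof -
  have "(\<Prod>i\<in>UNIV. (x $ i) ^ \<beta> i) =
    (\<Sum>\<alpha> | (\<Sum>i\<in>UNIV. \<alpha> i) \<le> t. (if \<alpha> = \<beta> then 1 else 0) * (\<Prod>i\<in>UNIV. (x $ i) ^ \<alpha> i))" for x :: "real ^ 'n"
    using assms by (simp add: if_distrib[of "\<lambda>u. u * _"] finite_exponents cong: if_cong)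
  then show ?thesis unfolding poly_degree_le_def
    by (intro exI[of _ "\<lambda>\<alpha>. if \<alpha> = \<beta> then 1 else 0"] ext)
qed

lemma poly_degree_le_const: "poly_degree_le t (\<lambda>x. a)"
  using poly_degree_le_cmult[OF poly_degree_le_monomial[of "\<lambda>_. 0" t], of a] by simp

lemma poly_degree_le_sum:
  assumes "\<And>i. i \<in> I \<Longrightarrow> poly_degree_le t (P i)"
  shows "poly_degree_le t (\<lambda>x. \<Sum>i\<in>I. P i x)"
  using assms by (induction I rule: infinite_finite_induct)
    (auto intro!: poly_degree_le_const poly_degree_le_add)

lemma poly_degree_le_mult:
  fixes P Q :: "real ^ 'n \<Rightarrow> real"
  assumes "poly_degree_le r P" "poly_degree_le s Q" "r + s \<le> t"
  shows "poly_degree_le t (\<lambda>x. P x * Q x)"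
proof -
  obtain c d where cd: "P = (\<lambda>x. \<Sum>\<alpha> | (\<Sum>i\<in>UNIV. \<alpha> i) \<le> r. c \<alpha> * (\<Prod>i\<in>UNIV. (x $ i) ^ \<alpha> i))"
    "Q = (\<lambda>x. \<Sum>\<alpha> | (\<Sum>i\<in>UNIV. \<alpha> i) \<le> s. d \<alpha> * (\<Prod>i\<in>UNIV. (x $ i) ^ \<alpha> i))"
    using assms unfolding poly_degree_le_def by blast
  have "(\<lambda>x. P x * Q x) = (\<lambda>x. \<Sum>\<alpha> | (\<Sum>i\<in>UNIV. \<alpha> i) \<le> r. \<Sum>\<beta> | (\<Sum>i\<in>UNIV. \<beta> i) \<le> s.
      (c \<alpha> * d \<beta>) * (\<Prod>i\<in>UNIV. (x $ i) ^ (\<alpha> i + \<beta> i)))"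
    unfolding cd by (simp add: sum_product power_add prod.distrib mult_ac)
  moreover have "poly_degree_le t (\<lambda>x. \<Sum>\<alpha> | (\<Sum>i\<in>UNIV. \<alpha> i) \<le> r. \<Sum>\<beta> | (\<Sum>i\<in>UNIV. \<beta> i) \<le> s.
      (c \<alpha> * d \<beta>) * (\<Prod>i\<in>UNIV. (x $ i) ^ (\<alpha> i + \<beta> i)))"
    using assms(3)
    by (intro poly_degree_le_sum poly_degree_le_cmult poly_degree_le_monomial) (auto simp: sum.distrib)
  ultimately show ?thesis by simp
qed

lemma poly_degree_le_affine: "poly_degree_le 1 (\<lambda>x. a \<bullet> x + b)"
proof -
  have "poly_degree_le 1 (\<lambda>x. x $ i)" for i :: 'a
  proof -
    have "x $ i = (\<Prod>j\<in>UNIV. (x $ j) ^ (if j = i then 1 else 0))" for x :: "real ^ 'a"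
      by (simp add: if_distrib[of "power _"] cong: if_cong)
    then have "(\<lambda>x :: real ^ 'a. x $ i) = (\<lambda>x. \<Prod>j\<in>UNIV. (x $ j) ^ (if j = i then 1 else 0))" by blast
    moreover have "poly_degree_le 1 (\<lambda>x :: real ^ 'a. \<Prod>j\<in>UNIV. (x $ j) ^ (if j = i then 1 else 0))"
      by (intro poly_degree_le_monomial) simp
    ultimately show ?thesis by metis
  qed
  then show ?thesis unfolding inner_vec_def inner_real_def
    by (intro poly_degree_le_add poly_degree_le_const poly_degree_le_sum poly_degree_le_cmult)
qed

lemma poly_degree_le_power:
  "poly_degree_le (r * e) (\<lambda>x. P x ^ e)" if "poly_degree_le r P"
proof (induction e)
  case (Suc e)
  show ?case unfolding power_Suc using poly_degree_le_mult[OF that Suc, of "r * Suc e"] by simp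
qed (simp add: poly_degree_le_const)

lemma poly_degree_le_prod:
  assumes "\<And>i. i \<in> I \<Longrightarrow> poly_degree_le r (P i)"
  shows "poly_degree_le (card I * r) (\<lambda>x. \<Prod>i\<in>I. P i x)"
  using assms
proof (induction I rule: infinite_finite_induct)
  case (insert i I)
  then show ?case
    using poly_degree_le_mult[of r "P i" "card I * r" "\<lambda>x. \<Prod>i\<in>I. P i x"] by auto
qed (simp_all add: poly_degree_le_const)

lemma poly_degree_le_poly_affine:
  assumes "degree q \<le> d"
  shows "poly_degree_le d (\<lambda>x. poly q (a \<bullet> x + b))"
proof -
  have "poly_degree_le d (\<lambda>x. \<Sum>i\<le>degree q. coeff q i * (a \<bullet> x + b) ^ i)"
  proof (intro poly_degree_le_sum poly_degree_le_cmult)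
    fix i assume "i \<in> {..degree q}"
    then show "poly_degree_le d (\<lambda>x. (a \<bullet> x + b) ^ i)"
      using assms poly_degree_le_power[OF poly_degree_le_affine[of a b], of i]
      by (auto intro: poly_degree_le_mono)
  qed
  then show ?thesis by (simp add: poly_altdef)
qed

lemma continuous_on_poly_degree_le:
  assumes "poly_degree_le t P"
  shows "continuous_on A P"
proof -
  obtain c where "P = (\<lambda>x. \<Sum>\<alpha> | (\<Sum>i\<in>UNIV. \<alpha> i) \<le> t. c \<alpha> * (\<Prod>i\<in>UNIV. (x $ i) ^ \<alpha> i))"
    using assms unfolding poly_degree_le_def by blast
  then show ?thesis by (auto intro!: continuous_intros)
qed

text \<open>The sum of a polynomial over the two values \<open>(\<surd>x \<plusminus> \<surd>a)\<^sup>2\<close> is symmetric in them, hence a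
  polynomial in their sum \<open>2x + 2a\<close> and product \<open>(x - a)\<^sup>2\<close>.\<close>

lemma power_symmetric_poly:
  "\<exists>q :: real poly. degree q \<le> e \<and>
     (\<forall>x\<ge>0. poly q x = ((sqrt x - r)\<^sup>2) ^ e + ((sqrt x + r)\<^sup>2) ^ e)"
proof (induction e rule: induct_nat_012)
  case 0
  show ?case by (intro exI[of _ "[:2:]"]) simp
next
  case 1
  show ?case by (intro exI[of _ "[:2 * r\<^sup>2, 2:]"]) (auto simp: power2_eq_square algebra_simps)
next
  case (ge2 e)
  then obtain q p where q: "degree q \<le> e" "\<forall>x\<ge>0. poly q x = ((sqrt x - r)\<^sup>2) ^ e + ((sqrt x + r)\<^sup>2) ^ e"
    and p: "degree p \<le> Suc e" "\<forall>x\<ge>0. poly p x = ((sqrt x - r)\<^sup>2) ^ Suc e + ((sqrt x + r)\<^sup>2) ^ Suc e"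
    by blast
  show ?case
  \<comment> \<open>Newton's recurrence for the power sums of \<open>u\<close> and \<open>v\<close>
    below: the linear factor is their sum, the quadratic factor their product.\<close>
  proof (intro exI[of _ "[:2 * r\<^sup>2, 2:] * p - [:r ^ 4, -2 * r\<^sup>2, 1:] * q"] conjI allI impI)
    have "degree ([:2 * r\<^sup>2, 2:] * p) \<le> Suc (Suc e)"
      using p(1) degree_mult_le[of "[:2 * r\<^sup>2, 2:]" p] by simp
    moreover have "degree ([:r ^ 4, -2 * r\<^sup>2, 1:] * q) \<le> Suc (Suc e)"
      using q(1) degree_mult_le[of "[:r ^ 4, -2 * r\<^sup>2, 1:]" q] by simp
    ultimately show "degree ([:2 * r\<^sup>2, 2:] * p - [:r ^ 4, -2 * r\<^sup>2, 1:] * q) \<le> Suc (Suc e)"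
      by (rule degree_diff_le)
    fix x :: real assume x: "0 \<le> x"
    define u v where "u = (sqrt x - r)\<^sup>2" and "v = (sqrt x + r)\<^sup>2"
    have uv: "2 * r\<^sup>2 + 2 * x = u + v" "r ^ 4 - 2 * r\<^sup>2 * x + x\<^sup>2 = u * v"
    proof -
      have "u * v = ((sqrt x)\<^sup>2 - r\<^sup>2)\<^sup>2"
        by (simp add: u_def v_def power2_eq_square algebra_simps)
      also have "\<dots> = r ^ 4 - 2 * r\<^sup>2 * x + x\<^sup>2"
        using x by (simp add: power2_eq_square algebra_simps power4_eq_xxxx)
      finally show "r ^ 4 - 2 * r\<^sup>2 * x + x\<^sup>2 = u * v" by simp
      show "2 * r\<^sup>2 + 2 * x = u + v"
        using x by (simp add: u_def v_def power2_eq_square algebra_simps)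
    qed
    have "poly ([:2 * r\<^sup>2, 2:] * p - [:r ^ 4, -2 * r\<^sup>2, 1:] * q) x =
       (2 * r\<^sup>2 + 2 * x) * poly p x - (r ^ 4 - 2 * r\<^sup>2 * x + x\<^sup>2) * poly q x"
      by (simp add: power2_eq_square algebra_simps)
    also have "\<dots> = (u + v) * (u ^ Suc e + v ^ Suc e) - u * v * (u ^ e + v ^ e)"
      using x q(2) p(2) by (simp only: uv) (simp add: u_def v_def)
    also have "\<dots> = u ^ Suc (Suc e) + v ^ Suc (Suc e)"
      by (simp add: algebra_simps)
    finally show "poly ([:2 * r\<^sup>2, 2:] * p - [:r ^ 4, -2 * r\<^sup>2, 1:] * q) x =
        ((sqrt x - r)\<^sup>2) ^ Suc (Suc e) + ((sqrt x + r)\<^sup>2) ^ Suc (Suc e)"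
      by (simp only: u_def v_def)
  qed
qed

lemma symmetric_poly:
  fixes p :: "real poly"
  obtains q where "degree q \<le> degree p"
    "\<And>x. 0 \<le> x \<Longrightarrow> poly q x = poly p ((sqrt x - r)\<^sup>2) + poly p ((sqrt x + r)\<^sup>2)"
proof -
  obtain s :: "nat \<Rightarrow> real poly" where s: "\<And>e. degree (s e) \<le> e"
    "\<And>e x. 0 \<le> x \<Longrightarrow> poly (s e) x = ((sqrt x - r)\<^sup>2) ^ e + ((sqrt x + r)\<^sup>2) ^ e"
    using power_symmetric_poly[of _ r] by metis
  show ?thesis
  proof
    show "degree (\<Sum>i\<le>degree p. smult (coeff p i) (s i)) \<le> degree p"
      using s(1) by (intro degree_sum_le) (auto intro: order_trans[OF degree_smult_le] order_trans)
    show "poly (\<Sum>i\<le>degree p. smult (coeff p i) (s i)) x = poly p ((sqrt x - r)\<^sup>2) + poly p ((sqrt x + r)\<^sup>2)"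
      if "0 \<le> x" for x
      by (simp add: poly_sum s(2)[OF that] poly_altdef[of p] distrib_left sum.distrib)
  qed
qed

section \<open>Affine changes of variables\<close>

lemma integrable_inverse_one_plus_square: "integrable lborel (\<lambda>x::real. 1 / (1 + x\<^sup>2))"
proof -
  have "set_integrable lborel (einterval (-\<infinity>) \<infinity>) (\<lambda>x::real. 1 / (1 + x\<^sup>2))"
  proof (rule interval_integral_FTC_nonneg(1)[where F = arctan])
    fix x :: real
    show "(arctan has_real_derivative 1 / (1 + x\<^sup>2)) (at x)"
      using DERIV_arctan[of x] by (simp add: inverse_eq_divide)
    show "isCont (\<lambda>x. 1 / (1 + x\<^sup>2)) x"
      by (intro continuous_intros) (simp add: add_nonneg_eq_0_iff)
  qed (auto simp: ereal_tendsto_simps tendsto_arctan_at_top tendsto_arctan_at_bot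
         intro: tendsto_arctan_at_top tendsto_arctan_at_bot)
  then show ?thesis by (simp add: set_integrable_def)
qed

text \<open>A common integrable majorant for the bumps. The product form, rather than a radial one,
  reduces its integrability by Tonelli to one variable, where \<open>arctan\<close> is an
  antiderivative.\<close>

definition cauchy_kernel :: "real ^ 'n \<Rightarrow> real" where
  "cauchy_kernel u = (\<Prod>i\<in>UNIV. 1 / (1 + (u $ i)\<^sup>2))"

lemma cauchy_kernel_pos: "0 < cauchy_kernel u"
  by (auto simp: cauchy_kernel_def intro!: prod_pos add_pos_nonneg)

lemma borel_measurable_cauchy_kernel [measurable]: "cauchy_kernel \<in> borel_measurable borel"
  unfolding cauchy_kernel_def[abs_def] by measurable

lemma nn_integral_cauchy_kernel:
  "(\<integral>\<^sup>+ u. ennreal (cauchy_kernel u) \<partial>(lborel :: (real ^ 'n) measure)) < \<infinity>"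
proof -
  let ?J = "\<integral>\<^sup>+ y. ennreal (1 / (1 + y\<^sup>2)) \<partial>(lborel :: real measure)"
  have J: "?J < \<infinity>"
    using integrable_inverse_one_plus_square by (subst nn_integral_eq_integral) auto
  have "ennreal (cauchy_kernel u) = (\<Prod>b\<in>Basis. ennreal (1 / (1 + (u \<bullet> b)\<^sup>2)))" for u :: "real ^ 'n"
  proof -
    have "ennreal (cauchy_kernel u) = (\<Prod>i\<in>UNIV. ennreal (1 / (1 + (u \<bullet> axis i 1)\<^sup>2)))"
      unfolding cauchy_kernel_def by (subst prod_ennreal[symmetric]) (auto simp: inner_axis)
    also have "\<dots> = (\<Prod>b\<in>range (\<lambda>i. axis i (1::real)). ennreal (1 / (1 + (u \<bullet> b)\<^sup>2)))"
      by (subst prod.reindex) (auto simp: inj_on_def axis_eq_axis)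
    also have "range (\<lambda>i. axis i (1::real)) = (Basis :: (real ^ 'n) set)"
      by (auto simp: Basis_vec_def)
    finally show ?thesis .
  qed
  then have "(\<integral>\<^sup>+ u. ennreal (cauchy_kernel u) \<partial>(lborel :: (real ^ 'n) measure)) =
     (\<integral>\<^sup>+ u. (\<Prod>b\<in>Basis. ennreal (1 / (1 + (u \<bullet> b)\<^sup>2))) \<partial>(lborel :: (real ^ 'n) measure))"
    by simp
  also have "\<dots> = (\<Prod>b\<in>(Basis :: (real ^ 'n) set). ?J)"
    by (subst nn_integral_lborel_prod[where f = "\<lambda>_ y. ennreal (1 / (1 + y\<^sup>2))"]) auto
  also have "\<dots> < \<infinity>"
    using J by (simp add: power_less_top_ennreal)
  finally show ?thesis .
qed

section \<open>Change of variables up to a constant factor\<close>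

lemma nn_integral_lborel_translate:
  fixes f :: "'a::euclidean_space \<Rightarrow> ennreal"
  assumes [measurable]: "f \<in> borel_measurable borel"
  shows "(\<integral>\<^sup>+ x. f (x + c) \<partial>lborel) = (\<integral>\<^sup>+ x. f x \<partial>lborel)"
proof -
  have "(\<integral>\<^sup>+ x. f x \<partial>lborel) = (\<integral>\<^sup>+ x. f x \<partial>distr lborel borel ((+) c))"
    by (simp add: lborel_distr_plus)
  also have "\<dots> = (\<integral>\<^sup>+ x. f (x + c) \<partial>lborel)"
    by (subst nn_integral_distr) (auto simp: add.commute)
  finally show ?thesis by simp
qed

text \<open>Determinants are avoided: the pushforward of Lebesgue measure under \<open>T\<close> is translation
  invariant, so Fubini for the kernel \<open>f (T p + y) g y\<close> gives uniqueness of Haar measure.\<close>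

lemma nn_integral_affine_bij:
  fixes T L :: "'a::euclidean_space \<Rightarrow> 'a"
  assumes L: "linear L" "inj L" and T: "\<And>p. T p = L p + b"
  obtains D where "0 < D"
    "\<And>f. f \<in> borel_measurable borel \<Longrightarrow> (\<integral>\<^sup>+ p. f (T p) \<partial>lborel) = ennreal D * (\<integral>\<^sup>+ u. f u \<partial>lborel)"
proof -
  obtain L' where L': "linear L'" "\<And>x. L (L' x) = x" "\<And>x. L' (L x) = x"
    using linear_injective_isomorphism[OF L] by blast
  have cL: "continuous_on A L" "continuous_on A L'" for A
    using L(1) L'(1) by (auto intro: linear_continuous_on simp: linear_conv_bounded_linear)
  have cT: "continuous_on A T" for A
    unfolding T[abs_def] by (intro continuous_intros cL)
  have [measurable]: "T \<in> borel_measurable borel"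
    using cT by (intro borel_measurable_continuous_onI)
  \<comment> \<open>\<open>T\<close> carries the translation by \<open>L' y\<close> to the
    translation by \<open>y\<close>, so the invariance of Lebesgue measure passes through
    \<open>T\<close>.\<close>
  have shift: "(\<integral>\<^sup>+ p. f (T p + y) \<partial>lborel) = (\<integral>\<^sup>+ p. f (T p) \<partial>lborel)"
    if [measurable]: "f \<in> borel_measurable borel" for f :: "'a \<Rightarrow> ennreal" and y
  proof -
    have "T p + y = T (p + L' y)" for p
      using L(1) by (simp add: T linear_add L')
    then show ?thesis
      using nn_integral_lborel_translate[of "\<lambda>p. f (T p)" "L' y"] by simp
  qed
  define B where "B = cbox 0 (One :: 'a)"
  define g :: "'a \<Rightarrow> ennreal" where "g = indicator B"
  have [measurable]: "g \<in> borel_measurable borel"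
    by (simp add: g_def B_def)
  have gint: "(\<integral>\<^sup>+ y. g y \<partial>lborel) = 1"
    by (simp add: g_def B_def inner_diff_left)
  \<comment> \<open>The factor is what the computation below leaves over: the volume of the preimage
    under \<open>T\<close> of the reflected unit cube.\<close>
  define D where "D = (\<integral>\<^sup>+ p. g (- T p) \<partial>lborel)"
  have main: "(\<integral>\<^sup>+ p. f (T p) \<partial>lborel) = D * (\<integral>\<^sup>+ u. f u \<partial>lborel)"
    if [measurable]: "f \<in> borel_measurable borel" for f :: "'a \<Rightarrow> ennreal"
  proof -
    have "(\<integral>\<^sup>+ p. f (T p) \<partial>lborel) = (\<integral>\<^sup>+ y. (\<integral>\<^sup>+ p. f (T p) \<partial>lborel) * g y \<partial>lborel)"
      by (subst nn_integral_cmult) (auto simp: gint)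
    also have "\<dots> = (\<integral>\<^sup>+ y. \<integral>\<^sup>+ p. f (T p + y) * g y \<partial>lborel \<partial>lborel)"
      by (intro nn_integral_cong) (subst nn_integral_multc, auto simp: shift)
    also have "\<dots> = (\<integral>\<^sup>+ p. \<integral>\<^sup>+ y. f (T p + y) * g y \<partial>lborel \<partial>lborel)"
      by (rule lborel_pair.Fubini') measurable
    also have "\<dots> = (\<integral>\<^sup>+ p. \<integral>\<^sup>+ y. f y * g (y - T p) \<partial>lborel \<partial>lborel)"
    proof (rule nn_integral_cong)
      fix p
      show "(\<integral>\<^sup>+ y. f (T p + y) * g y \<partial>lborel) = (\<integral>\<^sup>+ y. f y * g (y - T p) \<partial>lborel)"
        using nn_integral_lborel_translate[of "\<lambda>y. f y * g (y - T p)" "T p"] by (simp add: add.commute)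
    qed
    also have "\<dots> = (\<integral>\<^sup>+ y. \<integral>\<^sup>+ p. f y * g (y - T p) \<partial>lborel \<partial>lborel)"
      by (rule lborel_pair.Fubini') measurable
    also have "\<dots> = (\<integral>\<^sup>+ y. f y * D \<partial>lborel)"
    proof (rule nn_integral_cong)
      fix y
      have "(\<integral>\<^sup>+ p. g (y - T p) \<partial>lborel) = D"
        using shift[of "\<lambda>u. g (- u)" "- y"] by (simp add: D_def)
      then show "(\<integral>\<^sup>+ p. f y * g (y - T p) \<partial>lborel) = f y * D"
        by (subst nn_integral_cmult) auto
    qed
    also have "\<dots> = D * (\<integral>\<^sup>+ u. f u \<partial>lborel)"
      by (subst nn_integral_multc) (auto simp: mult.commute)
    finally show ?thesis .
  qed
  \<comment> \<open>This preimage is written as a continuous image of the cube, so that it is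
    compact and \<open>D\<close> is finite.\<close>
  define S where "S = (\<lambda>x. L' (- x - b)) ` B"
  have S: "g (- T p) = indicator S p" for p
  proof -
    have "- T p \<in> B \<longleftrightarrow> p \<in> S"
    proof
      assume "- T p \<in> B"
      moreover have "p = L' (- (- T p) - b)" by (simp add: T L')
      ultimately show "p \<in> S" unfolding S_def by blast
    next
      assume "p \<in> S"
      then show "- T p \<in> B" by (auto simp: S_def T L')
    qed
    then show ?thesis by (simp add: g_def indicator_def)
  qed
  have "compact S" unfolding S_def B_def
    by (intro compact_continuous_image continuous_intros continuous_on_compose2[OF cL(2)[of UNIV]]) auto
  then have "D < \<infinity>"
    unfolding D_def S using emeasure_compact_finite[of S] borel_compact[of S] by simp
  \<comment> \<open>With factor 0 the constant function 1 would have integral 0 over the whole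
    space.\<close>
  moreover have "D \<noteq> 0"
  proof
    assume "D = 0"
    then have "(\<integral>\<^sup>+ p. (\<lambda>_. 1) (T p) \<partial>lborel) = 0"
      by (subst main) auto
    then show False by (simp add: emeasure_lborel_UNIV)
  qed
  ultimately obtain d where "D = ennreal d" "0 < d"
    by (metis ennreal_cases ennreal_0 infinity_ennreal_def less_irrefl less_eq_real_def)
  then show ?thesis using that main by metis
qed

lemma integral_affine_bij:
  fixes T L :: "'a::euclidean_space \<Rightarrow> 'a"
  assumes L: "linear L" "inj L" and T: "\<And>p. T p = L p + b"
  obtains D where "0 < D"
    "\<And>f :: 'a \<Rightarrow> real. integrable lborel f \<Longrightarrow> (\<And>u. 0 \<le> f u) \<Longrightarrow> f \<in> borel_measurable borel \<Longrightarrow>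
       integrable lborel (\<lambda>p. f (T p)) \<and> (\<integral>p. f (T p) \<partial>lborel) = D * (\<integral>u. f u \<partial>lborel)"
proof -
  obtain D where D: "0 < D"
    "\<And>f. f \<in> borel_measurable borel \<Longrightarrow> (\<integral>\<^sup>+ p. f (T p) \<partial>lborel) = ennreal D * (\<integral>\<^sup>+ u. f u \<partial>lborel)"
    using nn_integral_affine_bij[OF assms] by blast
  have "continuous_on UNIV T"
    unfolding T[abs_def] using L by (intro continuous_intros linear_continuous_on) (simp add: linear_conv_bounded_linear)
  then have [measurable]: "T \<in> borel_measurable borel"
    by (rule borel_measurable_continuous_onI)
  show ?thesis
  proof
    fix f :: "'a \<Rightarrow> real"
    assume f: "integrable lborel f" "\<And>u. 0 \<le> f u" and [measurable]: "f \<in> borel_measurable borel"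
    have "(\<integral>\<^sup>+ p. ennreal (f (T p)) \<partial>lborel) = ennreal D * (\<integral>\<^sup>+ u. ennreal (f u) \<partial>lborel)"
      by (rule D(2)) measurable
    also have "\<dots> = ennreal (D * (\<integral>u. f u \<partial>lborel))"
      using f D(1) by (subst nn_integral_eq_integral) (auto simp: ennreal_mult)
    finally have *: "(\<integral>\<^sup>+ p. ennreal (f (T p)) \<partial>lborel) = ennreal (D * (\<integral>u. f u \<partial>lborel))" .
    have 2: "0 \<le> D * (\<integral>u. f u \<partial>lborel)" using f D(1) by simp
    show "integrable lborel (\<lambda>p. f (T p)) \<and> (\<integral>p. f (T p) \<partial>lborel) = D * (\<integral>u. f u \<partial>lborel)"
      using f * 2 by (subst (asm) nn_integral_eq_integrable) auto
  qed fact
qed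

lemma integrable_cauchy_kernel: "integrable lborel (cauchy_kernel :: real ^ 'n \<Rightarrow> real)"
  using nn_integral_cauchy_kernel cauchy_kernel_pos
  by (intro integrableI_nonneg) (auto intro: less_imp_le)

section \<open>Nodes of cubature formulas\<close>

lemma integral_uniform_measure_eq:
  fixes P :: "'a::euclidean_space \<Rightarrow> real"
  assumes "compact K" "0 < measure lborel K" "continuous_on UNIV P"
  shows "integral\<^sup>L (uniform_measure lborel K) P = (\<integral>x. indicator K x * P x \<partial>lborel) / measure lborel K"
proof -
  have [measurable]: "P \<in> borel_measurable borel" "K \<in> sets borel"
    using assms by (auto intro: borel_measurable_continuous_onI borel_compact)
  have "emeasure lborel K = ennreal (measure lborel K)"
    using emeasure_compact_finite[OF assms(1)] by (intro emeasure_eq_ennreal_measure) auto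
  then have "uniform_measure lborel K = density lborel (\<lambda>x. ennreal (indicator K x / measure lborel K))"
    unfolding uniform_measure_def using assms(2)
    by (intro arg_cong[of _ _ "density lborel"] ext) (auto simp: indicator_def divide_ennreal ennreal_1[symmetric] simp del: ennreal_1)
  then have "integral\<^sup>L (uniform_measure lborel K) P = (\<integral>x. (indicator K x / measure lborel K) * P x \<partial>lborel)"
    by (simp add: integral_density)
  also have "\<dots> = (\<integral>x. (indicator K x * P x) / measure lborel K \<partial>lborel)"
    by (intro Bochner_Integration.integral_cong) auto
  finally show ?thesis by simp
qed

lemma cubature_formula_integral:
  assumes "cubature_formula K t F w" "poly_degree_le t P" "compact K" "0 < measure lborel K"
  shows "(\<integral>x. indicator K x * P x \<partial>lborel) = measure lborel K * (\<Sum>p\<in>F. w p * P p)"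
  using assms integral_uniform_measure_eq[OF assms(3,4) continuous_on_poly_degree_le[OF assms(2)]]
  unfolding cubature_formula_def by (simp add: field_simps)

lemma cubature_formula_sum_weights:
  assumes "cubature_formula K t F w" "compact K" "0 < measure lborel K"
  shows "(\<Sum>p\<in>F. w p) = 1"
proof -
  have "K \<in> sets borel" using assms by (auto intro: borel_compact)
  then show ?thesis
    using cubature_formula_integral[OF assms(1) poly_degree_le_const[of t 1] assms(2,3)] assms(3) by simp
qed

lemma integrable_indicator_compact:
  fixes P :: "'a::euclidean_space \<Rightarrow> real"
  assumes "compact K" "continuous_on K P"
  shows "integrable lborel (\<lambda>x. indicator K x * P x)"
  using borel_integrable_compact[OF assms] by simp

text \<open>The formula is exact on \<open>G (R - Q)\<close>, whose integral is positive, so some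
  term of the weighted sum is positive. The conclusion keeps the product because a node may lie
  outside \<open>K\<close>, where the sign of \<open>G\<close> is left to the application.\<close>

lemma cubature_formula_node:
  assumes "cubature_formula K t F w" "positive_formula F w" "compact K" "0 < measure lborel K"
    and "poly_degree_le r G" "poly_degree_le s Q" "r + s \<le> t"
    and "(\<integral>x. indicator K x * (G x * Q x) \<partial>lborel) < R * (\<integral>x. indicator K x * G x \<partial>lborel)"
  obtains p where "p \<in> F" "0 < G p * (R - Q p)"
proof -
  note cont = continuous_on_poly_degree_le[OF assms(5), of K] continuous_on_poly_degree_le[OF assms(6), of K]
  have deg: "poly_degree_le t (\<lambda>x. G x * (R - Q x))"
    using poly_degree_le_mult[OF assms(5) poly_degree_le_add[OF poly_degree_le_const[of s R] poly_degree_le_cmult[OF assms(6), of "-1"]] assms(7)]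
    by simp
  have "(\<integral>x. indicator K x * (G x * (R - Q x)) \<partial>lborel) =
     (\<integral>x. R * (indicator K x * G x) - indicator K x * (G x * Q x) \<partial>lborel)"
    by (intro Bochner_Integration.integral_cong) (auto simp: algebra_simps)
  also have "\<dots> = R * (\<integral>x. indicator K x * G x \<partial>lborel) - (\<integral>x. indicator K x * (G x * Q x) \<partial>lborel)"
    using assms(3) cont
    by (subst Bochner_Integration.integral_diff) (auto intro!: integrable_indicator_compact integrable_mult_right continuous_intros)
  finally have "0 < measure lborel K * (\<Sum>p\<in>F. w p * (G p * (R - Q p)))"
    using assms(8) cubature_formula_integral[OF assms(1) deg assms(3,4)] by simp
  then have "0 < (\<Sum>p\<in>F. w p * (G p * (R - Q p)))"
    using assms(4) by (simp add: zero_less_mult_iff)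
  then obtain p where p: "p \<in> F" "0 < w p * (G p * (R - Q p))"
    by (meson linorder_not_le sum_nonpos)
  then have "0 < G p * (R - Q p)"
    using assms(2) unfolding positive_formula_def by (metis less_asym mult_pos_neg not_less_iff_gr_or_eq mult_zero_right)
  then show ?thesis using that p by blast
qed

lemma measure_le_integral_indicator:
  fixes f :: "'a::euclidean_space \<Rightarrow> real"
  assumes "compact K" "continuous_on K f" "S \<subseteq> K" "S \<in> sets borel" "0 \<le> c"
    and "\<And>x. x \<in> K \<Longrightarrow> 0 \<le> f x" "\<And>x. x \<in> S \<Longrightarrow> c \<le> f x"
  shows "c * measure lborel S \<le> (\<integral>x. indicator K x * f x \<partial>lborel)"
proof -
  have "emeasure lborel S < \<infinity>"
    using assms compact_imp_bounded bounded_subset emeasure_bounded_finite by metis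
  then have i: "integrable lborel (indicator S :: 'a \<Rightarrow> real)"
    using assms by (simp add: integrable_indicator_iff)
  have "c * measure lborel S = (\<integral>x. c * indicator S x \<partial>lborel)"
    using assms by simp
  also have "\<dots> \<le> (\<integral>x. indicator K x * f x \<partial>lborel)"
  proof (intro integral_mono integrable_indicator_compact integrable_mult_right)
    show "c * indicator S x \<le> indicator K x * f x" for x
      using assms(3-) by (auto simp: indicator_def)
  qed (use assms i in auto)
  finally show ?thesis .
qed

lemma integral_indicator_le:
  fixes f g :: "'a::euclidean_space \<Rightarrow> real"
  assumes "compact K" "continuous_on K f" "integrable lborel g"
    and "\<And>x. 0 \<le> g x" "\<And>x. x \<in> K \<Longrightarrow> f x \<le> g x"
  shows "(\<integral>x. indicator K x * f x \<partial>lborel) \<le> (\<integral>x. g x \<partial>lborel)"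
  using assms by (intro integral_mono integrable_indicator_compact) (auto simp: indicator_def)

text \<open>The unknown factor of \<open>integral_affine_bij\<close> is found by testing on the unit
  cube, whose preimage is a cube of side \<open>1/r\<close>.\<close>

lemma integral_scale_translate:
  fixes v :: "real ^ 'n"
  assumes r: "0 < r" and f: "integrable lborel f" "\<And>u. 0 \<le> f u" "f \<in> borel_measurable borel"
  shows "integrable lborel (\<lambda>p. f (r *\<^sub>R (p - v)))" (is ?int)
    and "(\<integral>p. f (r *\<^sub>R (p - v)) \<partial>lborel) = (\<integral>u. f u \<partial>lborel) / r ^ CARD('n)" (is ?eq)
proof -
  obtain D where D: "0 < D"
    "\<And>f :: real ^ 'n \<Rightarrow> real. integrable lborel f \<Longrightarrow> (\<And>u. 0 \<le> f u) \<Longrightarrow> f \<in> borel_measurable borel \<Longrightarrow>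
       integrable lborel (\<lambda>p. f (r *\<^sub>R (p - v))) \<and> (\<integral>p. f (r *\<^sub>R (p - v)) \<partial>lborel) = D * (\<integral>u. f u \<partial>lborel)"
    using integral_affine_bij[of "(*\<^sub>R) r" "\<lambda>p. r *\<^sub>R (p - v)" "- r *\<^sub>R v"] r
    by (auto simp: linear_scale_self inj_on_def algebra_simps)
  define B where "B = cbox 0 (One :: real ^ 'n)"
  have [measurable]: "B \<in> sets borel" by (simp add: B_def)
  have "integrable lborel (indicator B :: _ \<Rightarrow> real)"
    by (simp add: B_def integrable_indicator_iff)
  then have "(\<integral>p. indicator B (r *\<^sub>R (p - v)) \<partial>lborel) = D * measure lborel B"
    using D(2)[of "indicator B"] by simp
  also have "measure lborel B = 1" by (simp add: B_def inner_diff_left)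
  also have "(\<integral>p. indicator B (r *\<^sub>R (p - v)) \<partial>lborel) = (\<integral>p. indicat_real (cbox v (v + (1 / r) *\<^sub>R One)) p \<partial>lborel)"
  proof (intro Bochner_Integration.integral_cong refl)
    fix p
    have "r *\<^sub>R (p - v) \<in> B \<longleftrightarrow> p \<in> cbox v (v + (1 / r) *\<^sub>R One)"
      using r by (auto simp: B_def mem_box inner_diff_left inner_add_left field_simps)
    then show "indicator B (r *\<^sub>R (p - v)) = (indicator (cbox v (v + (1 / r) *\<^sub>R One)) p :: real)"
      by (simp add: indicator_def)
  qed
  also have "\<dots> = measure lborel (cbox v (v + (1 / r) *\<^sub>R One))" by simp
  also have "\<dots> = 1 / r ^ CARD('n)"
    using r by (subst measure_lborel_cbox) (auto simp: inner_add_left power_one_over)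
  finally have "D = 1 / r ^ CARD('n)" by simp
  then show ?int ?eq
    using D(2)[OF f] by auto
qed

text \<open>Each factor satisfies \<open>1 + (u $ i)\<^sup>2 \<le> (1 + norm u)\<^sup>2\<close>.
  Decay in the norm of order \<open>2n\<close> is thereby dominated by the integrable product
  kernel.\<close>

lemma cauchy_kernel_ge:
  fixes u :: "real ^ 'n"
  shows "1 / (1 + norm u) ^ (2 * CARD('n)) \<le> cauchy_kernel u"
proof -
  have "(\<Prod>i\<in>(UNIV :: 'n set). 1 / (1 + norm u)\<^sup>2) \<le> cauchy_kernel u"
    unfolding cauchy_kernel_def
  proof (intro prod_mono conjI divide_left_mono)
    fix i
    have "\<bar>u $ i\<bar>\<^sup>2 \<le> (norm u)\<^sup>2" by (intro power_mono component_le_norm_cart) auto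
    then show "1 + (u $ i)\<^sup>2 \<le> (1 + norm u)\<^sup>2"
      using norm_ge_zero[of u] by (simp add: power2_sum del: norm_ge_zero)
    show "0 < (1 + norm u)\<^sup>2 * (1 + (u $ i)\<^sup>2)"
      by (intro mult_pos_pos add_pos_nonneg zero_less_power) auto
  qed auto
  then show ?thesis by (simp add: power_one_over[symmetric] power_mult)
qed

text \<open>A generator \<open>v\<close> of maximal norm is exposed by the functional
  \<open>v\<close> itself: expanding \<open>norm (v - p)\<^sup>2 > 0\<close> gives a strict
  inequality at every other generator, and finiteness makes it linear in the distance.\<close>

lemma polytope_strict_vertex:
  fixes K :: "'a::euclidean_space set"
  assumes "polytope K" "K \<noteq> {}"
  obtains v c where "v \<in> K" "0 < c" "c \<le> 1" "\<And>p. p \<in> K \<Longrightarrow> c * norm (p - v) \<le> v \<bullet> v - v \<bullet> p"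
proof -
  obtain V where V: "finite V" "K = convex hull V"
    using assms unfolding polytope_def by blast
  with assms have "V \<noteq> {}" by auto
  have "Max (norm ` V) \<in> norm ` V" using V \<open>V \<noteq> {}\<close> by simp
  then obtain v where v: "v \<in> V" "norm v = Max (norm ` V)" by auto
  have pos: "0 < v \<bullet> v - v \<bullet> p" if "p \<in> V" "p \<noteq> v" for p
  proof -
    have le: "norm p \<le> norm v" unfolding v(2) using V that by simp
    have "0 < (norm (v - p))\<^sup>2" using that by simp
    also have "\<dots> = v \<bullet> v - 2 * (v \<bullet> p) + p \<bullet> p"
      by (simp add: power2_norm_eq_inner inner_diff inner_commute algebra_simps)
    also have "p \<bullet> p \<le> v \<bullet> v" using le by (simp add: norm_le)
    finally show ?thesis by simp
  qed
  \<comment> \<open>Inserting 1 keeps the minimum defined when \<open>v\<close> is the only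
    generator, and yields \<open>c \<le> 1\<close>.\<close>
  define c where "c = Min (insert 1 ((\<lambda>p. (v \<bullet> v - v \<bullet> p) / norm (p - v)) ` (V - {v})))"
  have c: "0 < c" "c \<le> 1"
    using V pos by (auto simp: c_def)
  have cV: "c * norm (p - v) \<le> v \<bullet> v - v \<bullet> p" if "p \<in> V" for p
  proof (cases "p = v")
    case False
    then have "c \<le> (v \<bullet> v - v \<bullet> p) / norm (p - v)"
      using V that by (auto simp: c_def)
    then show ?thesis using False by (simp add: field_simps)
  qed simp
  \<comment> \<open>The inequality bounds a convex function by an affine one, so it passes from the
    generators to their hull.\<close>
  have "convex {p. c * norm (p - v) \<le> v \<bullet> v - v \<bullet> p}"
  proof (rule convexI, clarify)
    fix x y and a b :: real
    assume xy: "c * norm (x - v) \<le> v \<bullet> v - v \<bullet> x" "c * norm (y - v) \<le> v \<bullet> v - v \<bullet> y"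
      and ab: "0 \<le> a" "0 \<le> b" "a + b = 1"
    have "a *\<^sub>R x + b *\<^sub>R y - v = a *\<^sub>R x + b *\<^sub>R y - (a + b) *\<^sub>R v" using ab by simp
    also have "\<dots> = a *\<^sub>R (x - v) + b *\<^sub>R (y - v)" by (simp add: algebra_simps)
    finally have "norm (a *\<^sub>R x + b *\<^sub>R y - v) \<le> a * norm (x - v) + b * norm (y - v)"
      using ab norm_triangle_ineq[of "a *\<^sub>R (x - v)" "b *\<^sub>R (y - v)"] by simp
    then have "c * norm (a *\<^sub>R x + b *\<^sub>R y - v) \<le> c * (a * norm (x - v) + b * norm (y - v))"
      using c by (intro mult_left_mono) auto
    also have "\<dots> = a * (c * norm (x - v)) + b * (c * norm (y - v))" by (simp add: algebra_simps)
    also have "\<dots> \<le> a * (v \<bullet> v - v \<bullet> x) + b * (v \<bullet> v - v \<bullet> y)"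
      using ab xy by (intro add_mono mult_left_mono) auto
    also have "\<dots> = (a + b) * (v \<bullet> v) - v \<bullet> (a *\<^sub>R x + b *\<^sub>R y)"
      by (simp add: inner_add_right algebra_simps)
    finally show "c * norm (a *\<^sub>R x + b *\<^sub>R y - v) \<le> v \<bullet> v - v \<bullet> (a *\<^sub>R x + b *\<^sub>R y)"
      using ab by simp
  qed
  then have "K \<subseteq> {p. c * norm (p - v) \<le> v \<bullet> v - v \<bullet> p}"
    unfolding V(2) using cV by (intro hull_minimal) auto
  moreover have "v \<in> K" using v V by (simp add: hull_inc)
  ultimately show ?thesis using that c by blast
qed

section \<open>Weights\<close>

lemma polytope_full_dim:
  fixes K :: "(real ^ 'n) set"
  assumes "polytope K" "aff_dim K = int CARD('n)"
  shows "compact K" "convex K" "interior K \<noteq> {}" "K = closure (interior K)" "0 < measure lborel K"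
proof -
  show K: "compact K" "convex K"
    using assms by (auto simp: polytope_imp_compact polytope_imp_convex)
  have "aff_dim K = int DIM(real ^ 'n)" using assms by simp
  then show i: "interior K \<noteq> {}"
    using K(2) interior_rel_interior_gen[of K] rel_interior_eq_empty[OF K(2)] by force
  show "K = closure (interior K)"
    using convex_closure_interior[OF K(2) i] compact_imp_closed[OF K(1)] by simp
  obtain x e where e: "0 < e" "ball x e \<subseteq> K"
    using i by (auto simp: mem_interior)
  have "0 < measure lebesgue (ball x e)" using content_ball_pos[OF e(1), of x] by simp
  also have "\<dots> \<le> measure lebesgue K"
    using e K by (intro measure_mono_fmeasurable lmeasurable_compact) auto
  also have "\<dots> = measure lborel K"
    using K by (simp add: measure_completion borel_compact)
  finally show "0 < measure lborel K" .
qed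

text \<open>Two bumps of the same degree estimate are used: one with scale \<open>\<Lambda>\<close>
  locates a node with \<open>k\<^sup>2 l < R\<close>, the other with scale \<open>M\<close> is
  bounded below at that node and has a small integral over \<open>K\<close>.\<close>

lemma least_weight_bound:
  fixes K :: "(real ^ 'n) set"
  assumes "polytope K" "aff_dim K = int CARD('n)"
  obtains C where "0 < C" "\<And>t F w. 1 \<le> t \<Longrightarrow> cubature_formula K t F w \<Longrightarrow> positive_formula F w \<Longrightarrow>
     \<exists>p\<in>F. w p \<le> C / real t ^ (2 * CARD('n))"
proof -
  note K = polytope_full_dim[OF assms]
  have "K \<noteq> {}" using K(3) interior_subset by fastforce
  then obtain v c where v: "v \<in> K" "0 < c" "c \<le> 1" "\<And>p. p \<in> K \<Longrightarrow> c * norm (p - v) \<le> v \<bullet> v - v \<bullet> p"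
    using polytope_strict_vertex[OF assms(1)] by metis
  define l where "l p = (- v) \<bullet> p + v \<bullet> v" for p
  have l_ge: "c * norm (p - v) \<le> l p" if "p \<in> K" for p
    using v(4)[OF that] by (simp add: l_def)
  have l_nonneg: "0 \<le> l p" if "p \<in> K" for p
    using l_ge[OF that] v(2) by (meson mult_nonneg_nonneg norm_ge_zero less_imp_le order_trans)
  have cl: "continuous_on A l" for A unfolding l_def[abs_def] by (intro continuous_intros)
  obtain \<Lambda>0 where \<Lambda>0: "\<And>p. p \<in> K \<Longrightarrow> l p \<le> \<Lambda>0"
    using compact_imp_bounded[OF compact_continuous_image[OF cl K(1)]] unfolding bounded_real by (meson abs_le_D1 image_eqI)
  define \<Lambda> where "\<Lambda> = max 1 \<Lambda>0"
  have \<Lambda>: "1 \<le> \<Lambda>" "\<And>p. p \<in> K \<Longrightarrow> l p \<le> \<Lambda>" using \<Lambda>0 by (auto simp: \<Lambda>_def le_max_iff_disj)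
  \<comment> \<open>Of the \<open>2n + 1\<close> powers of decay in \<open>1 + k\<^sup>2 l\<close>,
    one absorbs the factor \<open>1 + k\<^sup>2 l\<close> in \<open>bump_bound\<close>, and
    \<open>2n\<close> are compared with \<open>cauchy_kernel\<close>.\<close>
  define m where "m = 2 * CARD('n) + 1"
  define V where "V = measure lborel K"
  define J where "J = (\<integral>u. cauchy_kernel u \<partial>(lborel :: (real ^ 'n) measure))"
  have J: "0 \<le> J" unfolding J_def by (intro integral_nonneg_AE) (simp add: cauchy_kernel_pos less_imp_le)
  have V: "0 < V" using K by (simp add: V_def)
  define B where "B M = (2 * M / c) ^ m" for M
  have B: "0 \<le> B M" if "1 \<le> M" for M using v that by (simp add: B_def)
  have bump_bound: "poly (bump m M j) (l p) * (1 + (real (2 * j + 1))\<^sup>2 * l p)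
      \<le> B M * cauchy_kernel ((real (2 * j + 1))\<^sup>2 *\<^sub>R (p - v))"
    if "p \<in> K" "1 \<le> M" "l p \<le> M" for p M j
  proof -
    define k where "k = real (2 * j + 1)"
    define u where "u = k\<^sup>2 *\<^sub>R (p - v)"
    define a where "a = 1 + k\<^sup>2 * l p"
    have a: "1 \<le> a" using l_nonneg[OF that(1)] by (simp add: a_def)
    have "c * (1 + norm u) = c + k\<^sup>2 * (c * norm (p - v))"
      by (simp add: u_def distrib_left mult.left_commute)
    also have "\<dots> \<le> a" unfolding a_def using v l_ge[OF that(1)] by (intro add_mono mult_left_mono) auto
    finally have cu: "c * (1 + norm u) \<le> a" .
    have cu0: "0 < c * (1 + norm u)" using v by (simp add: add_pos_nonneg)
    have "poly (bump m M j) (l p) * a \<le> (2 * M / a) ^ m * a"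
      using bump_le[OF that(2) l_nonneg[OF that(1)] that(3), of m j] a
      by (intro mult_right_mono) (auto simp: a_def k_def)
    also have "\<dots> = (2 * M) ^ m / a ^ (2 * CARD('n))"
      using a by (simp add: m_def power_divide)
    also have "\<dots> \<le> (2 * M) ^ m / (c * (1 + norm u)) ^ (2 * CARD('n))"
      using cu cu0 that v(2) a by (intro divide_left_mono power_mono mult_pos_pos zero_less_power) (auto intro: add_pos_nonneg)
    also have "\<dots> = (2 * M) ^ m / c ^ (2 * CARD('n)) * (1 / (1 + norm u) ^ (2 * CARD('n)))"
      by (simp add: power_mult_distrib)
    also have "\<dots> \<le> B M * cauchy_kernel u"
    proof (intro mult_mono cauchy_kernel_ge)
      have "c ^ m \<le> c ^ (2 * CARD('n))" using v by (intro power_decreasing) (auto simp: m_def)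
      then show "(2 * M) ^ m / c ^ (2 * CARD('n)) \<le> B M"
        unfolding B_def power_divide using v that by (intro divide_left_mono) auto
    qed (use B that in auto)
    finally show ?thesis by (simp add: a_def u_def k_def)
  qed
  have scale: "integrable lborel (\<lambda>p. B M * cauchy_kernel (k\<^sup>2 *\<^sub>R (p - v)))"
     "(\<integral>p. B M * cauchy_kernel (k\<^sup>2 *\<^sub>R (p - v)) \<partial>lborel) = B M * J / k ^ (2 * CARD('n))" if "1 \<le> k" for k M
  proof -
    have "0 < k\<^sup>2" using that by simp
    note s = integral_scale_translate[OF this integrable_cauchy_kernel less_imp_le[OF cauchy_kernel_pos]
        borel_measurable_cauchy_kernel, of v]
    show "integrable lborel (\<lambda>p. B M * cauchy_kernel (k\<^sup>2 *\<^sub>R (p - v)))"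
      using s(1) by simp
    show "(\<integral>p. B M * cauchy_kernel (k\<^sup>2 *\<^sub>R (p - v)) \<partial>lborel) = B M * J / k ^ (2 * CARD('n))"
      using s(2) by (simp add: J_def power_mult)
  qed
  \<comment> \<open>The quotient of the bound \<open>up\<close> for the integral of
    \<open>G Q\<close> by the bound \<open>low\<close> for that of \<open>G\<close>; the powers of
    \<open>k\<close> cancel, and the summand 1 makes the comparison strict.\<close>
  define R where "R = B \<Lambda> * J * 4 ^ m / V + 1"
  have R: "0 < R" using B[OF \<Lambda>(1)] J V by (simp add: R_def add_nonneg_pos)
  \<comment> \<open>At least \<open>R\<close>, so that the wide bump is not small at the node; at
    least \<open>\<Lambda>\<close>, so that \<open>bump_le\<close> applies on all of
    \<open>K\<close>.\<close>
  define M where "M = max R \<Lambda>"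
  have M: "1 \<le> M" "R \<le> M" "\<Lambda> \<le> M" using \<Lambda> by (auto simp: M_def)
  define C where "C = B M * J * 4 ^ m / V * (2 * real m) ^ (2 * CARD('n)) + 1"
  show ?thesis
  proof
    show "0 < C" using B[OF M(1)] J V by (simp add: C_def add_nonneg_pos)
    fix t F w assume t: "1 \<le> t" and cub: "cubature_formula K t F w" "positive_formula F w"
    \<comment> \<open>The largest \<open>j\<close> with \<open>2mj + 1 \<le> t\<close>; the extra
      degree is that of the affine factor \<open>k\<^sup>2 l\<close>.\<close>
    define j where "j = (t - 1) div (2 * m)"
    define k where "k = real (2 * j + 1)"
    have k: "1 \<le> k" by (simp add: k_def)
    have deg: "2 * m * j + 1 \<le> t"
      using t times_div_less_eq_dividend[of "2 * m" "t - 1"] unfolding j_def by linarith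
    have "t - 1 < 2 * m * (j + 1)"
      unfolding j_def using dividend_less_times_div[of "2 * m" "t - 1"] by (simp add: m_def)
    then have "t \<le> 2 * m * (2 * j + 1)" by simp
    then have tk: "real t \<le> 2 * real m * k"
      unfolding k_def by (metis of_nat_le_iff of_nat_mult of_nat_numeral)
    define G where "G N p = poly (bump m N j) (l p)" for N p
    have G0: "0 \<le> G N p" for N p by (simp add: G_def bump_nonneg)
    have cG: "continuous_on A (G N)" for A N unfolding G_def[abs_def] by (intro continuous_intros cl)
    have degG: "poly_degree_le (2 * m * j) (G N)" for N
      unfolding G_def[abs_def] l_def[abs_def] by (intro poly_degree_le_poly_affine degree_bump)
    have degl: "poly_degree_le 1 (\<lambda>p. k\<^sup>2 * l p)"
      unfolding l_def[abs_def] by (intro poly_degree_le_cmult poly_degree_le_affine)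
    \<comment> \<open>\<open>S\<close> is \<open>K\<close> contracted towards \<open>v\<close> by
      the factor \<open>k\<^sup>2\<close>. Its volume carries the power \<open>k\<close> to the
      \<open>-2n\<close>, and \<open>l \<le> \<Lambda> / k\<^sup>2\<close> on it because
      \<open>l v = 0\<close>.\<close>
    define S where "S = {p. k\<^sup>2 *\<^sub>R (p - v) \<in> (\<lambda>p. p - v) ` K}"
    have S_eq: "p \<in> S \<longleftrightarrow> v + k\<^sup>2 *\<^sub>R (p - v) \<in> K" for p
    proof -
      have "u \<in> (\<lambda>p. p - v) ` K \<longleftrightarrow> v + u \<in> K" for u
        by (auto intro!: image_eqI[of u _ "v + u"])
      then show ?thesis by (simp add: S_def)
    qed
    have S: "p \<in> K" "l p \<le> \<Lambda> / k\<^sup>2" if "p \<in> S" for p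
    proof -
      define q where "q = v + k\<^sup>2 *\<^sub>R (p - v)"
      have q: "q \<in> K" using that by (simp add: S_eq q_def)
      have p: "p = (1 - 1 / k\<^sup>2) *\<^sub>R v + (1 / k\<^sup>2) *\<^sub>R q"
        using k by (simp add: q_def algebra_simps)
      show "p \<in> K" unfolding p using k q v by (intro convexD[OF K(2)]) auto
      have "l p = l q / k\<^sup>2" unfolding p l_def by (simp add: inner_add_right algebra_simps add_divide_distrib diff_divide_distrib)
      then show "l p \<le> \<Lambda> / k\<^sup>2" using \<Lambda>(2)[OF q] k by (simp add: divide_right_mono)
    qed
    have cK0: "compact ((\<lambda>p. p - v) ` K)" using K(1) by (intro compact_continuous_image continuous_intros)
    have "S = (\<lambda>p. k\<^sup>2 *\<^sub>R (p - v)) -` ((\<lambda>p. p - v) ` K)" by (auto simp: S_def)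
    then have "closed S" using compact_imp_closed[OF cK0]
      by (auto intro!: continuous_closed_vimage continuous_intros)
    have "measure lborel S = (\<integral>p. indicator ((\<lambda>p. p - v) ` K) (k\<^sup>2 *\<^sub>R (p - v)) \<partial>lborel)"
      using \<open>closed S\<close> by (subst Bochner_Integration.integral_cong[OF refl, of _ _ "indicator S"]) (auto simp: S_def indicator_def)
    also have "\<dots> = measure lborel ((\<lambda>p. p - v) ` K) / (k\<^sup>2) ^ CARD('n)"
      using k borel_compact[OF cK0] emeasure_compact_finite[OF cK0]
      by (subst integral_scale_translate) (auto intro: borel_measurable_indicator)
    also have "measure lborel ((\<lambda>p. p - v) ` K) = V"
      using measure_translation_subtract[of v K] K(1) cK0
      by (simp add: V_def measure_completion borel_compact)
    finally have mS: "measure lborel S = V / k ^ (2 * CARD('n))" by (simp add: power_mult)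
    have low: "(1 / 4) ^ m * measure lborel S \<le> (\<integral>x. indicator K x * G \<Lambda> x \<partial>lborel)"
    proof (rule measure_le_integral_indicator[OF K(1) cG])
      show "(1 / 4) ^ m \<le> G \<Lambda> x" if "x \<in> S" for x
        unfolding G_def using \<Lambda> S(2)[OF that] by (intro bump_ge) (auto simp: k_def)
    qed (use S \<open>closed S\<close> G0 in auto)
    have GB: "G N p \<le> B N * cauchy_kernel (k\<^sup>2 *\<^sub>R (p - v))"
      "G N p * (k\<^sup>2 * l p) \<le> B N * cauchy_kernel (k\<^sup>2 *\<^sub>R (p - v))"
      if "p \<in> K" "1 \<le> N" "\<Lambda> \<le> N" for p N
    proof -
      have "0 \<le> G N p * (k\<^sup>2 * l p)" using G0 l_nonneg[OF that(1)] by simp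
      moreover have "G N p + G N p * (k\<^sup>2 * l p) \<le> B N * cauchy_kernel (k\<^sup>2 *\<^sub>R (p - v))"
        using bump_bound[of p N j] that \<Lambda>(2)[of p] by (simp add: G_def k_def distrib_left)
      ultimately show "G N p \<le> B N * cauchy_kernel (k\<^sup>2 *\<^sub>R (p - v))"
        "G N p * (k\<^sup>2 * l p) \<le> B N * cauchy_kernel (k\<^sup>2 *\<^sub>R (p - v))"
        using G0[of N p] by linarith+
    qed
    have up: "(\<integral>x. indicator K x * (G \<Lambda> x * (k\<^sup>2 * l x)) \<partial>lborel) \<le> B \<Lambda> * J / k ^ (2 * CARD('n))"
      unfolding scale(2)[OF k, symmetric] using GB(2) \<Lambda> B
      by (intro integral_indicator_le K scale k continuous_intros cG cl) (auto simp: cauchy_kernel_pos less_imp_le)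
    have "B \<Lambda> * J < R * ((1 / 4) ^ m * V)"
      using V by (simp add: R_def field_simps)
    then have "B \<Lambda> * J / k ^ (2 * CARD('n)) < R * ((1 / 4) ^ m * V) / k ^ (2 * CARD('n))"
      using k by (intro divide_strict_right_mono) auto
    also have "\<dots> = R * ((1 / 4) ^ m * measure lborel S)" by (simp add: mS)
    also have "\<dots> \<le> R * (\<integral>x. indicator K x * G \<Lambda> x \<partial>lborel)"
      using low R by (intro mult_left_mono) auto
    finally have "(\<integral>x. indicator K x * (G \<Lambda> x * (k\<^sup>2 * l x)) \<partial>lborel) < R * (\<integral>x. indicator K x * G \<Lambda> x \<partial>lborel)"
      using up by linarith
    then obtain p where p: "p \<in> F" "0 < G \<Lambda> p * (R - k\<^sup>2 * l p)"
      using cubature_formula_node[OF cub K(1,5) degG degl deg] by blast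
    \<comment> \<open>An even power is nonnegative everywhere, so this holds also for a node outside
      \<open>K\<close>.\<close>
    then have "k\<^sup>2 * l p < R" using G0[of \<Lambda> p] by (simp add: zero_less_mult_iff)
    then have "l p \<le> M / k\<^sup>2" using M k by (simp add: field_simps)
    then have Gp: "(1 / 4) ^ m \<le> G M p"
      unfolding G_def using M by (intro bump_ge) (auto simp: k_def)
    have w0: "0 < w q" if "q \<in> F" for q using cub(2) that by (simp add: positive_formula_def)
    have finF: "finite F" using cub(1) by (simp add: cubature_formula_def)
    \<comment> \<open>A single term is at most the whole sum, since all weights and all values of
      the bump are nonnegative. The sum is then turned back into the integral over
      \<open>K\<close>.\<close>
    have "V * (w p * (1 / 4) ^ m) \<le> V * (w p * G M p)"
      using Gp w0[OF p(1)] V by (intro mult_left_mono) auto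
    also have "\<dots> \<le> V * (\<Sum>q\<in>F. w q * G M q)"
      using V p(1) finF w0 G0 by (intro mult_left_mono member_le_sum) (auto intro: mult_nonneg_nonneg less_imp_le)
    also have "\<dots> = (\<integral>x. indicator K x * G M x \<partial>lborel)"
      unfolding V_def using deg
      by (intro cubature_formula_integral[OF cub(1) poly_degree_le_mono[OF degG] K(1,5), symmetric]) simp
    also have "\<dots> \<le> B M * J / k ^ (2 * CARD('n))"
      unfolding scale(2)[OF k, symmetric] using GB(1) M B
      by (intro integral_indicator_le K scale k cG) (auto simp: cauchy_kernel_pos less_imp_le)
    finally have "w p \<le> B M * J * 4 ^ m / V / k ^ (2 * CARD('n))"
      using V k by (simp add: field_simps)
    also have "\<dots> \<le> B M * J * 4 ^ m / V / (real t / (2 * real m)) ^ (2 * CARD('n))"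
      using tk t B[OF M(1)] J V k
      by (intro divide_left_mono power_mono mult_pos_pos zero_less_power) (auto simp: m_def field_simps)
    also have "\<dots> = (C - 1) / real t ^ (2 * CARD('n))"
      by (simp add: C_def power_divide)
    also have "\<dots> \<le> C / real t ^ (2 * CARD('n))"
      by (intro divide_right_mono) auto
    finally show "\<exists>p\<in>F. w p \<le> C / real t ^ (2 * CARD('n))" using p(1) by blast
  qed
qed

section \<open>The path metric\<close>

locale facet_metric =
  fixes K :: "(real ^ 'n) set" and x :: "(real ^ 'n) set \<Rightarrow> real ^ 'n \<Rightarrow> real"
  assumes polytope: "polytope K" and full_dim: "aff_dim K = int CARD('n)"
    and facet_functions: "facet_functions K x"
begin

lemmas K_props = polytope_full_dim[OF polytope full_dim]

definition grad :: "(real ^ 'n) set \<Rightarrow> real ^ 'n" where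
  "grad f = (SOME a. \<exists>b. \<forall>p. x f p = a \<bullet> p + b)"

lemma finite_facets: "finite {f. f facet_of K}"
  by (simp add: finite_polyhedron_facets polytope polytope_imp_polyhedron)

lemma x_affine: "x f p = grad f \<bullet> p + x f 0" if "f facet_of K"
proof -
  have "\<exists>a b. \<forall>p. x f p = a \<bullet> p + b" using facet_functions that unfolding facet_functions_def by blast
  then have "\<exists>b. \<forall>p. x f p = grad f \<bullet> p + b" unfolding grad_def by (rule someI_ex)
  then show ?thesis by auto
qed

lemma x_diff: "x f q - x f p = grad f \<bullet> (q - p)" if "f facet_of K"
  using x_affine[OF that, of q] x_affine[OF that, of p] by (simp add: inner_diff_right)

lemma x_convex: "x f ((1 - s) *\<^sub>R p + s *\<^sub>R q) = (1 - s) * x f p + s * x f q" if "f facet_of K"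
  unfolding x_affine[OF that, of p] x_affine[OF that, of q] x_affine[OF that, of "_ + _"]
  by (simp add: inner_add_right algebra_simps)

lemma continuous_on_x [continuous_intros]:
  "continuous_on A (\<lambda>y. x f (g y))" if "f facet_of K" "continuous_on A g"
  unfolding x_affine[OF that(1), of "g _"] by (intro continuous_intros that)

lemma x_pos: "0 < x f p" if "f facet_of K" "p \<in> interior K"
  using facet_functions that unfolding facet_functions_def by blast

lemma x_nonneg: "0 \<le> x f p" if "f facet_of K" "p \<in> K"
proof -
  have "p \<in> closure (interior K)" using that K_props by blast
  moreover have "continuous_on (closure (interior K)) (x f)" using continuous_on_x[OF that(1) continuous_on_id] by simp
  ultimately show ?thesis
    using continuous_ge_on_closure[of "interior K" "x f" p 0] x_pos[OF that(1)] less_imp_le by blast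
qed

lemma line_element_eq: "line_element K x p v = sqrt (\<Sum>f | f facet_of K. (grad f \<bullet> v)\<^sup>2 / x f p)"
proof -
  have "frechet_derivative (x f) (at p) = (\<lambda>v. grad f \<bullet> v)" if "f facet_of K" for f
  proof -
    have "x f = (\<lambda>p. grad f \<bullet> p + x f 0)" using x_affine[OF that] by blast
    moreover have "((\<lambda>p. grad f \<bullet> p + x f 0) has_derivative (\<lambda>v. grad f \<bullet> v)) (at p)"
      by (auto intro!: derivative_eq_intros)
    ultimately show ?thesis using frechet_derivative_at by metis
  qed
  then show ?thesis unfolding line_element_def by (intro arg_cong[of _ _ sqrt] sum.cong) auto
qed

text \<open>The factor 2 comes from the antiderivative \<open>2 sqrt x\<close> of
  \<open>1 / sqrt x\<close>. The summands add up to an upper bound for the length of a segment,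
  while being explicit and continuous up to the boundary.\<close>

definition sqrt_dist :: "real ^ 'n \<Rightarrow> real ^ 'n \<Rightarrow> real" where
  "sqrt_dist p q = (\<Sum>f | f facet_of K. 2 * \<bar>sqrt (x f p) - sqrt (x f q)\<bar>)"

lemma sqrt_dist_commute: "sqrt_dist p q = sqrt_dist q p"
  by (simp add: sqrt_dist_def abs_minus_commute)

lemma sqrt_dist_self [simp]: "sqrt_dist p p = 0"
  by (simp add: sqrt_dist_def)

definition has_length :: "(real \<Rightarrow> real ^ 'n) \<Rightarrow> real \<Rightarrow> bool" where
  "has_length \<gamma> L \<longleftrightarrow> ((\<lambda>s. line_element K x (\<gamma> s) (vector_derivative \<gamma> (at s))) has_integral L) {0..1}"

lemma facet_integral:
  assumes f: "f facet_of K" and pq: "p \<in> interior K" "q \<in> interior K"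
  shows "((\<lambda>s. \<bar>grad f \<bullet> (q - p)\<bar> / sqrt (x f (linepath p q s))) has_integral
     2 * \<bar>sqrt (x f p) - sqrt (x f q)\<bar>) {0..1}"
proof -
  define d where "d = grad f \<bullet> (q - p)"
  have d: "d = x f q - x f p" using x_diff[OF f] by (simp add: d_def)
  have pos: "0 < x f p" "0 < x f q" using x_pos f pq by auto
  have y: "x f (linepath p q s) = x f p + s * d" for s
    unfolding linepath_def x_convex[OF f] d by (simp add: algebra_simps)
  have ypos: "0 < x f p + s * d" if "s \<in> {0..1}" for s
  proof -
    have "0 < (1 - s) * x f p + s * x f q"
      using pos that by (cases "s = 0") (auto intro: add_nonneg_pos)
    then show ?thesis by (simp add: d algebra_simps)
  qed
  \<comment> \<open>The function \<open>x f\<close> is affine along the segment, so its derivative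
    \<open>d\<close> has constant sign, and \<open>sgn d\<close> turns the absolute value into an
    exact derivative.\<close>
  have "((\<lambda>s. \<bar>d\<bar> / sqrt (x f p + s * d)) has_integral
      (2 * sgn d * sqrt (x f p + 1 * d) - 2 * sgn d * sqrt (x f p + 0 * d))) {0..1}"
  proof (rule fundamental_theorem_of_calculus)
    fix s :: real assume s: "s \<in> {0..1}"
    have "((\<lambda>s. 2 * sgn d * sqrt (x f p + s * d)) has_real_derivative
       2 * sgn d * (d * (inverse (sqrt (x f p + s * d)) / 2))) (at s within {0..1})"
      using ypos[OF s] by (auto intro!: derivative_eq_intros simp: field_simps)
    moreover have "2 * sgn d * (d * (inverse (sqrt (x f p + s * d)) / 2)) = \<bar>d\<bar> / sqrt (x f p + s * d)"
      by (simp add: abs_sgn field_simps)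
    ultimately show "((\<lambda>s. 2 * sgn d * sqrt (x f p + s * d)) has_vector_derivative
       \<bar>d\<bar> / sqrt (x f p + s * d)) (at s within {0..1})"
      by (simp add: has_real_derivative_iff_has_vector_derivative)
  qed simp
  moreover have "2 * sgn d * sqrt (x f p + 1 * d) - 2 * sgn d * sqrt (x f p + 0 * d) =
      2 * \<bar>sqrt (x f p) - sqrt (x f q)\<bar>"
    using pos by (cases "x f p" "x f q" rule: linorder_cases) (auto simp: d sgn_if)
  ultimately show ?thesis by (simp add: y d_def[symmetric])
qed

text \<open>The line element is the Euclidean norm of the vector of facet contributions, hence at
  most their sum, which \<open>facet_integral\<close> integrates exactly.\<close>

lemma has_length_linepath:
  assumes pq: "p \<in> interior K" "q \<in> interior K"
  obtains L where "has_length (linepath p q) L" "L \<le> sqrt_dist p q"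
proof -
  have inK: "linepath p q s \<in> interior K" if "s \<in> {0..1}" for s
    using convex_interior[OF K_props(2)] pq that unfolding linepath_def by (auto intro: convexD)
  let ?h = "\<lambda>s. line_element K x (linepath p q s) (vector_derivative (linepath p q) (at s))"
  have "continuous_on {0..1} (\<lambda>s. sqrt (\<Sum>f | f facet_of K. (grad f \<bullet> (q - p))\<^sup>2 / x f (linepath p q s)))"
    using inK x_pos by (intro continuous_intros continuous_on_linepath) (auto simp: less_imp_neq[THEN not_sym])
  then have "continuous_on {0..1} ?h" by (simp add: line_element_eq)
  then obtain L where L: "(?h has_integral L) {0..1}"
    using integrable_continuous_real unfolding integrable_on_def by blast
  have "L \<le> sqrt_dist p q"
  proof (rule has_integral_le[OF L])
    show "((\<lambda>s. \<Sum>f | f facet_of K. \<bar>grad f \<bullet> (q - p)\<bar> / sqrt (x f (linepath p q s))) has_integral sqrt_dist p q) {0..1}"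
      unfolding sqrt_dist_def using facet_integral pq finite_facets by (intro has_integral_sum) auto
    fix s :: real assume s: "s \<in> {0..1}"
    have "?h s = L2_set (\<lambda>f. \<bar>grad f \<bullet> (q - p)\<bar> / sqrt (x f (linepath p q s))) {f. f facet_of K}"
      unfolding line_element_eq L2_set_def using inK[OF s] x_pos
      by (intro arg_cong[of _ _ sqrt] sum.cong) (auto simp: power_divide less_imp_le)
    also have "\<dots> \<le> (\<Sum>f | f facet_of K. \<bar>grad f \<bullet> (q - p)\<bar> / sqrt (x f (linepath p q s)))"
      using inK[OF s] x_pos by (intro L2_set_le_sum) (auto simp: less_imp_le)
    finally show "?h s \<le> (\<Sum>f | f facet_of K. \<bar>grad f \<bullet> (q - p)\<bar> / sqrt (x f (linepath p q s)))" .
  qed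
  then show ?thesis using that L by (auto simp: has_length_def)
qed

text \<open>Each half of the joined path runs at double speed, and the line element is homogeneous
  in the velocity. The junction and the finitely many points without a derivative do not affect the
  integral.\<close>

lemma has_length_join:
  assumes "has_length g1 L1" "has_length g2 L2" "valid_path g1" "valid_path g2"
  shows "has_length (g1 +++ g2) (L1 + L2)"
proof -
  obtain s1 s2
    where s1: "finite s1" "\<forall>x\<in>{0..1} - s1. g1 differentiable at x"
      and s2: "finite s2" "\<forall>x\<in>{0..1} - s2. g2 differentiable at x"
    using assms
    by (auto simp: valid_path_def piecewise_C1_differentiable_on_def C1_differentiable_on_eq)
  have le2: "line_element K x p (2 *\<^sub>R v) = 2 * line_element K x p v" for p v
    unfolding line_element_eq
    by (simp add: power_mult_distrib sum_distrib_left[symmetric] real_sqrt_mult flip: times_divide_eq_right)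
  let ?l = "\<lambda>g s. line_element K x (g s) (vector_derivative g (at s))"
  have i1: "((\<lambda>s. 2 * ?l g1 (2 * s)) has_integral L1) {0..1/2}"
   and i2: "((\<lambda>s. 2 * ?l g2 (2 * s - 1)) has_integral L2) {1/2..1}"
    using has_integral_affinity01 [OF assms(1)[unfolded has_length_def], where m = 2 and c = 0, THEN has_integral_cmul [where c = 2]]
          has_integral_affinity01 [OF assms(2)[unfolded has_length_def], where m = 2 and c = "-1", THEN has_integral_cmul [where c = 2]]
    by (simp_all only: image_affinity_atLeastAtMost_div_diff, simp_all)
  have d1: "vector_derivative (g1 +++ g2) (at z) = 2 *\<^sub>R vector_derivative g1 (at (2 * z))"
    if z: "0 \<le> z" "2 * z < 1" "2 * z \<notin> s1" for z
  proof (rule vector_derivative_at [OF has_vector_derivative_transform_within])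
    show "0 < \<bar>z - 1/2\<bar>" using z by auto
    have "((*) 2 has_vector_derivative 2) (at z)"
      by (simp add: has_vector_derivative_def has_derivative_def bounded_linear_mult_left)
    moreover have "(g1 has_vector_derivative vector_derivative g1 (at (2 * z))) (at (2 * z))"
      using s1 z by (auto simp: vector_derivative_works)
    ultimately show "((\<lambda>x. g1 (2 * x)) has_vector_derivative 2 *\<^sub>R vector_derivative g1 (at (2 * z))) (at z)"
      by (intro vector_diff_chain_at [simplified o_def])
  qed (use z in \<open>simp_all add: joinpaths_def dist_real_def abs_if split: if_split_asm\<close>)
  have d2: "vector_derivative (g1 +++ g2) (at z) = 2 *\<^sub>R vector_derivative g2 (at (2 * z - 1))"
    if z: "1 < 2 * z" "z \<le> 1" "2 * z - 1 \<notin> s2" for z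
  proof (rule vector_derivative_at [OF has_vector_derivative_transform_within])
    show "0 < \<bar>z - 1/2\<bar>" using z by auto
    have "((\<lambda>x. 2 * x - 1) has_vector_derivative 2) (at z)"
      by (simp add: has_vector_derivative_def has_derivative_def bounded_linear_mult_left)
    moreover have "(g2 has_vector_derivative vector_derivative g2 (at (2 * z - 1))) (at (2 * z - 1))"
      using s2 z by (auto simp: vector_derivative_works)
    ultimately show "((\<lambda>x. g2 (2 * x - 1)) has_vector_derivative 2 *\<^sub>R vector_derivative g2 (at (2 * z - 1))) (at z)"
      by (intro vector_diff_chain_at [simplified o_def])
  qed (use z in \<open>simp_all add: joinpaths_def dist_real_def abs_if split: if_split_asm\<close>)
  have "(?l (g1 +++ g2) has_integral L1) {0..1/2}"
  proof (rule has_integral_spike_finite [OF _ _ i1])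
    show "finite (insert (1/2) ((*) 2 -` s1))"
      using s1 by (force intro: finite_vimageI [where h = "(*) 2"] inj_onI)
    show "?l (g1 +++ g2) z = 2 * ?l g1 (2 * z)" if "z \<in> {0..1/2} - insert (1/2) ((*) 2 -` s1)" for z
    proof -
      have "?l (g1 +++ g2) z = line_element K x (g1 (2 * z)) (2 *\<^sub>R vector_derivative g1 (at (2 * z)))"
        using that by (subst d1) (auto simp: joinpaths_def)
      then show ?thesis by (simp only: le2)
    qed
  qed
  moreover have "(?l (g1 +++ g2) has_integral L2) {1/2..1}"
  proof (rule has_integral_spike_finite [OF _ _ i2])
    show "finite (insert (1/2) ((\<lambda>s. 2 * s - 1) -` s2))"
      using s2 by (force intro: finite_vimageI [where h = "\<lambda>s. 2 * s - 1"] inj_onI)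
    show "?l (g1 +++ g2) z = 2 * ?l g2 (2 * z - 1)" if "z \<in> {1/2..1} - insert (1/2) ((\<lambda>s. 2 * s - 1) -` s2)" for z
    proof -
      have "?l (g1 +++ g2) z = line_element K x (g2 (2 * z - 1)) (2 *\<^sub>R vector_derivative g2 (at (2 * z - 1)))"
        using that by (subst d2) (auto simp: joinpaths_def)
      then show ?thesis by (simp only: le2)
    qed
  qed
  ultimately show ?thesis unfolding has_length_def
    by (intro has_integral_combine[where c = "1/2"]) auto
qed

section \<open>Infimum of lengths and its extension to the boundary\<close>

definition lengths :: "real ^ 'n \<Rightarrow> real ^ 'n \<Rightarrow> real set" where
  "lengths p q = {L. \<exists>\<gamma>. valid_path \<gamma> \<and> pathstart \<gamma> = p \<and> pathfinish \<gamma> = q \<and>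
     path_image \<gamma> \<subseteq> interior K \<and> has_length \<gamma> L}"

lemma interior_path_dist_eq: "interior_path_dist K x p q = Inf (lengths p q)"
  unfolding interior_path_dist_def lengths_def has_length_def ..

lemma lengths_nonneg: "0 \<le> L" if L: "L \<in> lengths p q"
proof -
  obtain \<gamma> where \<gamma>: "path_image \<gamma> \<subseteq> interior K" "has_length \<gamma> L"
    using L unfolding lengths_def by blast
  show ?thesis
  proof (rule has_integral_nonneg[OF \<gamma>(2)[unfolded has_length_def]])
    fix s :: real assume "s \<in> {0..1}"
    then have "\<gamma> s \<in> interior K" using \<gamma>(1) unfolding path_image_def by blast
    then show "0 \<le> line_element K x (\<gamma> s) (vector_derivative \<gamma> (at s))"
      unfolding line_element_eq using x_pos by (auto intro!: sum_nonneg simp: less_imp_le)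
  qed
qed

lemma interior_path_dist_le: "interior_path_dist K x p q \<le> L" if "L \<in> lengths p q"
  unfolding interior_path_dist_eq using that lengths_nonneg by (intro cInf_lower) (auto intro: bdd_belowI[of _ 0])

lemma lengths_segment:
  assumes "p \<in> interior K" "q \<in> interior K"
  obtains L where "L \<in> lengths p q" "L \<le> sqrt_dist p q"
proof -
  obtain L where L: "has_length (linepath p q) L" "L \<le> sqrt_dist p q"
    using has_length_linepath[OF assms] by blast
  have "closed_segment p q \<subseteq> interior K"
    using assms convex_interior[OF K_props(2)] by (simp add: closed_segment_subset)
  then have "L \<in> lengths p q"
    unfolding lengths_def using L(1) by (auto intro!: exI[of _ "linepath p q"])
  then show ?thesis using that L(2) by blast
qed

lemma interior_path_dist_le_sqrt_dist:
  "interior_path_dist K x p q \<le> sqrt_dist p q" if "p \<in> interior K" "q \<in> interior K"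
  using lengths_segment[OF that] interior_path_dist_le order_trans by metis

lemma interior_path_dist_triangle:
  assumes "p \<in> interior K" "q \<in> interior K" "r \<in> interior K"
  shows "interior_path_dist K x p r \<le> interior_path_dist K x p q + interior_path_dist K x q r"
proof -
  have *: "interior_path_dist K x p r \<le> L1 + L2" if L: "L1 \<in> lengths p q" "L2 \<in> lengths q r" for L1 L2
  proof (rule interior_path_dist_le)
    obtain g1 g2 where "valid_path g1" "pathstart g1 = p" "pathfinish g1 = q" "path_image g1 \<subseteq> interior K" "has_length g1 L1"
      "valid_path g2" "pathstart g2 = q" "pathfinish g2 = r" "path_image g2 \<subseteq> interior K" "has_length g2 L2"
      using L unfolding lengths_def by blast
    then show "L1 + L2 \<in> lengths p r"
      unfolding lengths_def
      by (auto intro!: exI[of _ "g1 +++ g2"] valid_path_join has_length_join simp: path_image_join)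
  qed
  \<comment> \<open>\<open>Inf\<close> on the reals is meaningful only for nonempty sets bounded
    below; segments supply the elements. The two infima are then taken one after the other.\<close>
  have ne: "lengths p q \<noteq> {}" "lengths q r \<noteq> {}" using lengths_segment assms by blast+
  have "interior_path_dist K x p r - L1 \<le> interior_path_dist K x q r" if "L1 \<in> lengths p q" for L1
    unfolding interior_path_dist_eq[of q r] using ne *[OF that] by (intro cInf_greatest) (auto simp: algebra_simps)
  then have "interior_path_dist K x p r - interior_path_dist K x q r \<le> interior_path_dist K x p q"
    unfolding interior_path_dist_eq[of p q] using ne by (intro cInf_greatest) (auto simp: algebra_simps)
  then show ?thesis by simp
qed

text \<open>\<open>A\<close> is arbitrary because \<open>sqrt\<close> is extended to negative reals
  as an odd function and is continuous on the whole line.\<close>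

lemma continuous_on_sqrt_dist: "continuous_on A (\<lambda>z. sqrt_dist (fst z) (snd z))"
  unfolding sqrt_dist_def by (intro continuous_intros) auto

lemma sqrt_dist_uniformly_small:
  assumes "0 < e"
  obtains d where "0 < d" "\<And>p q. p \<in> K \<Longrightarrow> q \<in> K \<Longrightarrow> dist p q < d \<Longrightarrow> sqrt_dist p q < e"
proof -
  have "uniformly_continuous_on (K \<times> K) (\<lambda>z. sqrt_dist (fst z) (snd z))"
    using K_props(1) by (intro compact_uniformly_continuous continuous_on_sqrt_dist compact_Times)
  then obtain d where d: "0 < d" "\<And>y z. y \<in> K \<times> K \<Longrightarrow> z \<in> K \<times> K \<Longrightarrow> dist z y < d \<Longrightarrow>
      dist (sqrt_dist (fst z) (snd z)) (sqrt_dist (fst y) (snd y)) < e"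
    using assms unfolding uniformly_continuous_on_def by meson
  have "sqrt_dist p q < e" if "p \<in> K" "q \<in> K" "dist p q < d" for p q
    \<comment> \<open>The function vanishes on the diagonal, so \<open>(p, q)\<close> is compared
      with \<open>(q, q)\<close>.\<close>
    using d(2)[of "(q, q)" "(p, q)"] that by (simp add: dist_Pair_Pair)
  then show ?thesis using that d(1) by blast
qed

text \<open>\<open>Lim\<close> has the intended value only where the limit exists. By the triangle
  inequality the interior distance changes by at most the \<open>sqrt_dist\<close> moved by its
  endpoints, so it is uniformly continuous and extends to the closure; the bound then passes to the
  limit.\<close>

lemma path_dist_le_sqrt_dist:
  assumes "p \<in> K" "q \<in> K"
  shows "path_dist K x p q \<le> sqrt_dist p q"
proof -
  let ?S = "interior K \<times> interior K"
  let ?d = "\<lambda>(p, q). interior_path_dist K x p q"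
  have close: "interior_path_dist K x p q \<le> interior_path_dist K x p' q' + sqrt_dist p p' + sqrt_dist q q'"
    if "p \<in> interior K" "q \<in> interior K" "p' \<in> interior K" "q' \<in> interior K" for p q p' q'
    using interior_path_dist_triangle[of p p' q] interior_path_dist_triangle[of p' q' q]
      interior_path_dist_le_sqrt_dist[of p p'] interior_path_dist_le_sqrt_dist[of q' q] that
    by (simp add: sqrt_dist_commute)
  have "uniformly_continuous_on ?S ?d"
    unfolding uniformly_continuous_on_def
  proof (intro allI impI)
    fix e :: real assume "0 < e"
    then obtain d where d: "0 < d" "\<And>p q. p \<in> K \<Longrightarrow> q \<in> K \<Longrightarrow> dist p q < d \<Longrightarrow> sqrt_dist p q < e / 2"
      using sqrt_dist_uniformly_small[of "e / 2"] by auto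
    have "dist (?d z') (?d z) < e" if z: "z \<in> ?S" "z' \<in> ?S" "dist z' z < d" for z z'
    proof -
      obtain p q p' q' where eq: "z = (p, q)" "z' = (p', q')" by (cases z, cases z')
      have "dist p' p < d" "dist q' q < d"
        using z dist_fst_le[of z' z] dist_snd_le[of z' z] by (auto simp: eq)
      then have "sqrt_dist p' p < e / 2" "sqrt_dist q' q < e / 2"
        using z d(2) interior_subset[of K] by (auto simp: eq)
      then show ?thesis
        using close[of p q p' q'] close[of p' q' p q] z
        by (simp add: eq dist_real_def sqrt_dist_commute abs_less_iff)
    qed
    then show "\<exists>d>0. \<forall>z\<in>?S. \<forall>z'\<in>?S. dist z' z < d \<longrightarrow> dist (?d z') (?d z) < e"
      using d(1) by blast
  qed
  moreover have cl: "(p, q) \<in> closure ?S"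
    using assms K_props(4) by (auto simp: closure_Times)
  ultimately obtain l where l: "(?d \<longlongrightarrow> l) (at (p, q) within ?S)"
    using uniformly_continuous_on_extension_at_closure by metis
  \<comment> \<open>The filter \<open>at ... within\<close> omits the point itself, so membership in
    the closure is not enough; for an open set of positive dimension it implies being a limit
    point.\<close>
  have "(p, q) islimpt ?S"
    using cl interior_limit_point[of "(p, q)" ?S] by (auto simp: closure_def interior_Times)
  then have nontriv: "\<not> trivial_limit (at (p, q) within ?S)"
    by (simp add: trivial_limit_within)
  have "((\<lambda>z. sqrt_dist (fst z) (snd z)) \<longlongrightarrow> sqrt_dist p q) (at (p, q) within ?S)"
  proof -
    have "continuous (at (p, q) within ?S) (\<lambda>z. sqrt_dist (fst z) (snd z))"
      using continuous_on_sqrt_dist[of UNIV] continuous_on_eq_continuous_at[of UNIV]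
      by (auto intro: continuous_at_imp_continuous_at_within)
    then show ?thesis by (simp add: continuous_within)
  qed
  moreover have "eventually (\<lambda>z. ?d z \<le> sqrt_dist (fst z) (snd z)) (at (p, q) within ?S)"
    unfolding eventually_at_filter
    by (intro always_eventually) (auto intro: interior_path_dist_le_sqrt_dist)
  ultimately have "l \<le> sqrt_dist p q"
    using tendsto_le[OF nontriv] l by blast
  moreover have "path_dist K x p q = l"
    unfolding path_dist_def using tendsto_Lim[OF nontriv l] .
  ultimately show ?thesis by simp
qed

end

section \<open>Facets and vertices\<close>

context facet_metric
begin

lemma x_facet_zero: "x f p = 0" if "f facet_of K" "p \<in> f"
  using facet_functions that unfolding facet_functions_def by blast

text \<open>A segment from an interior point to a point outside \<open>K\<close> crosses the
  frontier in some facet. There the facet function vanishes, although it is a combination of a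
  positive value, with positive weight, and a nonnegative one.\<close>

lemma mem_K_iff: "p \<in> K \<longleftrightarrow> (\<forall>f. f facet_of K \<longrightarrow> 0 \<le> x f p)"
proof
  assume *: "\<forall>f. f facet_of K \<longrightarrow> 0 \<le> x f p"
  show "p \<in> K"
  proof (rule ccontr)
    assume "p \<notin> K"
    obtain z where z: "z \<in> interior K" using K_props(3) by blast
    have "closed_segment z p \<inter> frontier K \<noteq> {}"
      using z \<open>p \<notin> K\<close> interior_subset[of K]
      by (intro connected_Int_frontier) (auto intro!: exI[of _ z] exI[of _ p])
    then obtain y where y: "y \<in> closed_segment z p" "y \<in> frontier K" by blast
    have "y \<in> rel_frontier K"
      using y(2) rel_interior_nonempty_interior[OF K_props(3)] by (simp add: frontier_def rel_frontier_def)
    then obtain f where f: "f facet_of K" "y \<in> f"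
      using rel_frontier_of_polyhedron[OF polytope_imp_polyhedron[OF polytope]] by auto
    obtain s where s: "0 \<le> s" "s \<le> 1" "y = (1 - s) *\<^sub>R z + s *\<^sub>R p"
      using y(1) unfolding closed_segment_def by blast
    have "y \<in> K" using f facet_of_imp_subset by blast
    then have "s < 1" using \<open>p \<notin> K\<close> s by (cases "s = 1") auto
    then have "0 < (1 - s) * x f z + s * x f p"
      using x_pos[OF f(1) z] * f(1) s(1) by (intro add_pos_nonneg) auto
    then show False using x_facet_zero[OF f] unfolding s(3) x_convex[OF f(1)] by simp
  qed
qed (use x_nonneg in blast)

text \<open>The zero set \<open>G\<close> of \<open>x f\<close> in \<open>K\<close> is a proper face
  that has \<open>f\<close> as a face. Since \<open>f\<close> already has codimension one, a
  dimension count forces \<open>f = G\<close>.\<close>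

lemma x_zero_imp_mem_facet:
  assumes f: "f facet_of K" and p: "p \<in> K" "x f p = 0"
  shows "p \<in> f"
proof -
  define G where "G = K \<inter> {y. grad f \<bullet> y = - x f 0}"
  have G: "y \<in> G \<longleftrightarrow> y \<in> K \<and> x f y = 0" for y
    using x_affine[OF f, of y] by (auto simp: G_def)
  have GK: "G face_of K" unfolding G_def
  proof (rule face_of_Int_supporting_hyperplane_ge[OF K_props(2)])
    fix y assume "y \<in> K"
    then show "grad f \<bullet> y \<ge> - x f 0" using x_nonneg[OF f, of y] x_affine[OF f, of y] by linarith
  qed
  have fK: "f face_of K" "f \<subseteq> K" using f by (auto simp: facet_of_def facet_of_imp_subset)
  have "f face_of G"
    using fK x_facet_zero[OF f] face_of_imp_subset[OF GK] by (intro face_of_subset[OF fK(1)]) (auto simp: G)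
  moreover have "G \<noteq> K"
  proof -
    obtain z where "z \<in> interior K" using K_props(3) by blast
    then show ?thesis using x_pos[OF f, of z] G[of z] interior_subset[of K] by auto
  qed
  then have "aff_dim G < aff_dim K"
    using face_of_aff_dim_lt[OF K_props(2) GK] by blast
  ultimately have "f = G"
    using face_of_aff_dim_lt[OF face_of_imp_convex[OF GK], of f] f unfolding facet_of_def by linarith
  then show ?thesis using p G by blast
qed

definition lip :: real where "lip = (\<Sum>f | f facet_of K. norm (grad f)) + 1"

lemma lip_pos: "0 < lip"
  unfolding lip_def by (intro add_nonneg_pos sum_nonneg) auto

lemma x_lipschitz: "\<bar>x f p - x f q\<bar> \<le> lip * norm (p - q)" if "f facet_of K"
proof -
  have "\<bar>x f p - x f q\<bar> \<le> norm (grad f) * norm (p - q)"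
    unfolding x_diff[OF that] by (rule Cauchy_Schwarz_ineq2)
  also have "norm (grad f) \<le> lip"
    using member_le_sum[of f "{f. f facet_of K}" "\<lambda>f. norm (grad f)"] that finite_facets
    unfolding lip_def by simp
  finally show ?thesis by (simp add: mult_right_mono)
qed

lemma x_pos_neighbourhood:
  assumes A: "A \<subseteq> {f. f facet_of K}" and p: "\<And>f. f \<in> A \<Longrightarrow> 0 < x f p"
  obtains e \<eta> where "0 < e" "0 < \<eta>" "\<And>f q. f \<in> A \<Longrightarrow> norm (q - p) < e \<Longrightarrow> \<eta> \<le> x f q"
proof -
  have fin: "finite A" using A finite_facets finite_subset by blast
  \<comment> \<open>Half of the minimum leaves room for the variation within the radius
    \<open>\<eta> / lip\<close>; the inserted 1 covers an empty \<open>A\<close>.\<close>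
  define \<eta> where "\<eta> = Min (insert 1 ((\<lambda>f. x f p) ` A)) / 2"
  have \<eta>: "0 < \<eta>" "\<And>f. f \<in> A \<Longrightarrow> 2 * \<eta> \<le> x f p" using fin p by (auto simp: \<eta>_def)
  show ?thesis
  proof
    show "0 < \<eta> / lip" using \<eta> lip_pos by simp
    fix f q assume f: "f \<in> A" and q: "norm (q - p) < \<eta> / lip"
    have "\<bar>x f q - x f p\<bar> \<le> lip * norm (q - p)" using f A by (intro x_lipschitz) auto
    also have "\<dots> \<le> lip * (\<eta> / lip)" using q lip_pos by (intro mult_left_mono) auto
    also have "\<dots> = \<eta>" using lip_pos by simp
    finally show "\<eta> \<le> x f q" using \<eta>(2)[OF f] by linarith
  qed fact
qed

text \<open>The facet functions that vanish at \<open>q\<close> cut out a face of \<open>K\<close>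
  containing \<open>q\<close>. Any vertex \<open>v\<close> of it lies on all those facets, so a
  facet that avoids \<open>v\<close> has a positive function at \<open>q\<close>.\<close>

lemma nearby_vertex:
  assumes "q \<in> K"
  obtains v where "v extreme_point_of K" "\<And>f. f facet_of K \<Longrightarrow> v \<notin> f \<Longrightarrow> 0 < x f q"
proof -
  define Z where "Z = {f. f facet_of K \<and> x f q = 0}"
  define G where "G = K \<inter> {p. \<forall>f\<in>Z. x f p = 0}"
  have "convex G" unfolding G_def
  proof (rule convex_Int[OF K_props(2)], rule convexI, clarify)
    fix a b u v f assume *: "\<forall>f\<in>Z. x f a = 0" "\<forall>f\<in>Z. x f b = 0" "0 \<le> u" "0 \<le> v" "u + v = (1::real)" "f \<in> Z"
    then have "u = 1 - v" by simp
    then show "x f (u *\<^sub>R a + v *\<^sub>R b) = 0" using * x_convex[of f v a b] by (simp only: Z_def mem_Collect_eq)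
  qed
  moreover have "compact G"
  proof -
    have "G = K \<inter> (\<Inter>f\<in>Z. {p. x f p = 0})" by (auto simp: G_def)
    moreover have "closed {p. x f p = 0}" if "f \<in> Z" for f
      using that by (intro closed_Collect_eq continuous_intros) (auto simp: Z_def)
    ultimately show ?thesis using K_props(1) by (simp add: compact_Int_closed closed_INT)
  qed
  moreover have "q \<in> G" using assms by (auto simp: G_def Z_def)
  ultimately obtain v where v: "v extreme_point_of G"
    using extreme_point_exists_convex[of G] by blast
  have "G face_of K" unfolding face_of_def
  proof (intro conjI ballI impI \<open>convex G\<close>)
    show "G \<subseteq> K" by (auto simp: G_def)
    fix a b y assume ab: "a \<in> K" "b \<in> K" "y \<in> G" "y \<in> open_segment a b"
    then obtain s where s: "0 < s" "s < 1" "y = (1 - s) *\<^sub>R a + s *\<^sub>R b" by (auto simp: in_segment)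
    have "x f a = 0 \<and> x f b = 0" if f: "f \<in> Z" for f
    proof -
      have fK: "f facet_of K" using f by (simp add: Z_def)
      have "(1 - s) * x f a + s * x f b = 0"
        using ab(3) f x_convex[OF fK, of s a b] s(3) by (simp add: G_def)
      moreover have "0 \<le> (1 - s) * x f a" "0 \<le> s * x f b" using x_nonneg[OF fK] ab s by auto
      ultimately show ?thesis using s by (simp add: add_nonneg_eq_0_iff)
    qed
    then show "a \<in> G" "b \<in> G" using ab by (auto simp: G_def)
  qed
  then have vK: "v extreme_point_of K" "v \<in> G"
    using v extreme_point_of_face by blast+
  have "0 < x f q" if "f facet_of K" "v \<notin> f" for f
  proof -
    have "f \<notin> Z" using that x_zero_imp_mem_facet[of f v] vK(2) by (auto simp: G_def)
    then show ?thesis using that x_nonneg[OF that(1) assms] by (auto simp: Z_def order_less_le)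
  qed
  then show ?thesis using that vK(1) by blast
qed

text \<open>Along a direction killed by all facet functions through \<open>v\<close>, one could move
  from \<open>v\<close> a little both ways without leaving \<open>K\<close>, the other facets being
  at positive distance. An extreme point is not such a midpoint.\<close>

lemma vertex_grad_inj:
  assumes v: "v extreme_point_of K" and d: "\<And>f. f facet_of K \<Longrightarrow> v \<in> f \<Longrightarrow> grad f \<bullet> d = 0"
  shows "d = 0"
proof (rule ccontr)
  assume "d \<noteq> 0"
  have vK: "v \<in> K" using v by (simp add: extreme_point_of_def)
  have "0 < x f v" if "f facet_of K" "v \<notin> f" for f
    using that x_zero_imp_mem_facet[of f v] x_nonneg[OF that(1) vK] vK by (auto simp: order_less_le)
  then obtain e \<eta> where e: "0 < e" "0 < \<eta>" "\<And>f q. f \<in> {f. f facet_of K \<and> v \<notin> f} \<Longrightarrow> norm (q - v) < e \<Longrightarrow> \<eta> \<le> x f q"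
    using x_pos_neighbourhood[of "{f. f facet_of K \<and> v \<notin> f}" v] by blast
  define h where "h = (e / (2 * norm d)) *\<^sub>R d"
  have h: "norm h < e" "h \<noteq> 0" using \<open>d \<noteq> 0\<close> e(1) by (auto simp: h_def)
  have mem: "v + g \<in> K" if g: "norm g < e" "\<And>f. f facet_of K \<Longrightarrow> v \<in> f \<Longrightarrow> grad f \<bullet> g = 0" for g
    unfolding mem_K_iff
  proof (intro allI impI)
    fix f assume f: "f facet_of K"
    show "0 \<le> x f (v + g)"
    proof (cases "v \<in> f")
      case True
      then show ?thesis using g(2)[OF f True] x_diff[OF f, of "v + g" v] x_facet_zero[OF f True] by simp
    next
      case False
      then show ?thesis using e(2) e(3)[of f "v + g"] f g(1) by simp
    qed
  qed
  have "v + h \<in> K" "v - h \<in> K"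
    using mem[of h] mem[of "- h"] h d by (auto simp: h_def)
  moreover have "v \<in> open_segment (v - h) (v + h)"
  proof -
    have "midpoint (v - h) (v + h) = v" by (simp add: midpoint_def algebra_simps scaleR_2[symmetric])
    moreover have "(v + h) - (v - h) = 2 *\<^sub>R h" by (simp add: scaleR_2)
    then have "v - h \<noteq> v + h" using h(2) by auto
    ultimately show ?thesis using midpoint_in_open_segment[of "v - h" "v + h"] by simp
  qed
  ultimately show False using v unfolding extreme_point_of_def by blast
qed

text \<open>Simplicity enters here: exactly \<open>n\<close> facets through \<open>v\<close> can be
  indexed by \<open>'n\<close>, and the injective map of gradients becomes an invertible change of
  coordinates.\<close>

lemma vertex_coordinates:
  assumes "simple_polytope K" and v: "v extreme_point_of K"
  obtains \<phi> :: "'n \<Rightarrow> (real ^ 'n) set" and c where "\<phi> ` UNIV = {f. f facet_of K \<and> v \<in> f}"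
    "0 < c" "\<And>d. c * norm d \<le> norm (\<chi> i. grad (\<phi> i) \<bullet> d)"
proof -
  have "card {f. f facet_of K \<and> v \<in> f} = CARD('n)"
    using assms by (simp add: simple_polytope_def)
  moreover have "finite {f. f facet_of K \<and> v \<in> f}" using finite_facets by (rule rev_finite_subset) auto
  ultimately obtain \<phi> where \<phi>: "bij_betw \<phi> (UNIV :: 'n set) {f. f facet_of K \<and> v \<in> f}"
    using finite_same_card_bij[of "UNIV :: 'n set"] by (metis finite_class.finite_UNIV)
  then have r: "\<phi> ` UNIV = {f. f facet_of K \<and> v \<in> f}" by (simp add: bij_betw_def)
  define L where "L d = (\<chi> i. grad (\<phi> i) \<bullet> d)" for d
  have "linear L" by (rule linearI) (auto simp: L_def vec_eq_iff inner_add_right)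
  moreover have "inj L"
  proof (subst linear_injective_0[OF \<open>linear L\<close>], intro allI impI)
    fix d assume "L d = 0"
    then have *: "grad (\<phi> i) \<bullet> d = 0" for i by (simp add: L_def vec_eq_iff)
    show "d = 0"
    proof (rule vertex_grad_inj[OF v])
      fix f assume "f facet_of K" "v \<in> f"
      then have "f \<in> \<phi> ` UNIV" using r by blast
      then show "grad f \<bullet> d = 0" using * by blast
    qed
  qed
  ultimately obtain c where c: "c > 0" "\<And>d. c * norm d \<le> norm (L d)"
    using linear_inj_bounded_below_pos by blast
  show ?thesis by (rule that[OF r c(1) c(2)[unfolded L_def]])
qed

end

text \<open>Otherwise \<open>\<bar>y - a\<bar> = d (sqrt y + sqrt a)\<close> with
  \<open>d > 2r/k\<close>. The second factor is at least \<open>sqrt a\<close> and at least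
  \<open>d\<close>; averaging the two resulting lower bounds contradicts the hypothesis.\<close>

lemma sqrt_close:
  fixes a y r k :: real
  assumes "0 \<le> a" "0 \<le> y" "0 < k" "1 \<le> r" "\<bar>y - a\<bar> \<le> r * ((sqrt a + 1 / k) / k)"
  shows "\<bar>sqrt y - sqrt a\<bar> \<le> 2 * r / k"
proof (rule ccontr)
  define d where "d = \<bar>sqrt y - sqrt a\<bar>"
  assume "\<not> ?thesis"
  then have d: "2 * r / k < d" by (simp add: d_def)
  have rk: "0 < r / k" using assms by simp
  have "y - a = (sqrt y - sqrt a) * (sqrt y + sqrt a)"
    using assms by (simp add: algebra_simps)
  then have ya: "\<bar>y - a\<bar> = d * (sqrt y + sqrt a)"
    using assms by (simp add: d_def abs_mult)
  have s: "0 \<le> sqrt a" "0 \<le> sqrt y" using assms by auto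
  then have dS: "d \<le> sqrt y + sqrt a" unfolding d_def by linarith
  have "2 * r / k * sqrt a \<le> d * (sqrt y + sqrt a)"
    using d rk s by (intro mult_mono) auto
  moreover have "2 * r / k * (2 * r / k) \<le> d * (sqrt y + sqrt a)"
    using d rk s dS by (intro mult_mono) auto
  moreover have "2 * r / k * (2 / k) \<le> 2 * r / k * (2 * r / k)"
    using assms by (intro mult_left_mono divide_right_mono) auto
  moreover have "0 < r / k * (1 / k)"
    using assms by simp
  moreover have "r * ((sqrt a + 1 / k) / k) = r / k * sqrt a + r / k * (1 / k)"
    by (simp add: add_divide_distrib distrib_left)
  ultimately show False using assms(5) ya by simp
qed

section \<open>Nodes near a given point\<close>

text \<open>The width \<open>\<sigma> = (\<surd>a + 1/k)/k\<close> is the length at \<open>a\<close> of a step of size \<open>1/k\<close> in the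
  coordinate \<open>\<surd>x\<close>, in which the metric \<open>dx\<^sup>2/x\<close> is flat.\<close>

lemma sqrt_bump:
  fixes a X \<Lambda> :: real and j :: nat
  assumes a: "0 \<le> a" "a \<le> X" and \<Lambda>: "1 \<le> \<Lambda>" "4 * X \<le> \<Lambda>"
  defines "k \<equiv> real (2 * j + 1)"
  defines "\<sigma> \<equiv> (sqrt a + 1 / k) / k"
  obtains g :: "real poly" where "degree g \<le> 8 * j"
    "\<And>y. 0 \<le> y \<Longrightarrow> 0 \<le> poly g y"
    "\<And>y. 0 \<le> y \<Longrightarrow> y \<le> X \<Longrightarrow> poly g y * (1 + ((y - a) / \<sigma>)\<^sup>2)\<^sup>2 \<le> 2 * (4 * \<Lambda>) ^ 4"
    "\<And>y. a \<le> y \<Longrightarrow> y \<le> a + \<sigma> \<Longrightarrow> (1 / 4) ^ 4 \<le> poly g y"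
proof -
  have k: "1 \<le> k" by (simp add: k_def)
  have \<sigma>: "0 < \<sigma>" using a k by (auto simp: \<sigma>_def intro!: divide_pos_pos add_nonneg_pos)
  obtain g where g: "degree g \<le> degree (bump 4 \<Lambda> j)"
    "\<And>y. 0 \<le> y \<Longrightarrow> poly g y = poly (bump 4 \<Lambda> j) ((sqrt y - sqrt a)\<^sup>2) + poly (bump 4 \<Lambda> j) ((sqrt y + sqrt a)\<^sup>2)"
    using symmetric_poly[of "bump 4 \<Lambda> j" "sqrt a"] by blast
  \<comment> \<open>Both arguments of the symmetrised bump, \<open>sqrt y - sqrt a\<close> and
    \<open>sqrt y + sqrt a\<close>, satisfy the conditions on \<open>s\<close>, so one estimate
    serves for both. The upper condition gives
    \<open>s\<^sup>2 \<le> 4X \<le> \<Lambda>\<close>.\<close>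
  have bound: "poly (bump 4 \<Lambda> j) (s\<^sup>2) * (1 + ((y - a) / \<sigma>)\<^sup>2)\<^sup>2 \<le> (4 * \<Lambda>) ^ 4"
    if y: "0 \<le> y" "y \<le> X" and s: "\<bar>sqrt y - sqrt a\<bar> \<le> \<bar>s\<bar>" "\<bar>s\<bar> \<le> sqrt y + sqrt a" for y s
  proof -
    define d where "d = \<bar>sqrt y - sqrt a\<bar>"
    define u where "u = \<bar>y - a\<bar> / \<sigma>"
    have u0: "0 \<le> u" using \<sigma> by (simp add: u_def)
    have d: "0 \<le> d" "sqrt y \<le> sqrt a + d" by (auto simp: d_def)
    have "y - a = (sqrt y - sqrt a) * (sqrt y + sqrt a)"
      using a y by (simp add: algebra_simps)
    then have "\<bar>y - a\<bar> = d * (sqrt y + sqrt a)"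
      using a y by (simp add: d_def abs_mult)
    also have "\<dots> \<le> d * (2 * sqrt a + d)" using d by (intro mult_left_mono) auto
    also have "\<dots> \<le> (2 * (k * d) + (k * d)\<^sup>2) * \<sigma>"
    proof -
      have "(2 * (k * d) + (k * d)\<^sup>2) * \<sigma> = d * (2 * sqrt a + d) + (2 * d / k + k * d\<^sup>2 * sqrt a)"
        using k unfolding \<sigma>_def by (simp add: field_simps power2_eq_square)
      moreover have "0 \<le> 2 * d / k + k * d\<^sup>2 * sqrt a" using d(1) k a by (intro add_nonneg_nonneg) auto
      ultimately show ?thesis by linarith
    qed
    finally have "u \<le> 2 * (k * d) + (k * d)\<^sup>2" using \<sigma> by (simp add: u_def field_simps)
    moreover have "2 * (k * d) \<le> 1 + (k * d)\<^sup>2" using sum_squares_bound[of "k * d" 1] by simp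
    ultimately have "1 + u \<le> 2 * (1 + (k * d)\<^sup>2)" by argo
    also have "(k * d)\<^sup>2 \<le> k\<^sup>2 * s\<^sup>2"
      using s(1) d(1) unfolding d_def[symmetric] power_mult_distrib
      by (intro mult_left_mono) (metis power2_abs power_mono, simp)
    finally have us: "1 + u \<le> 2 * (1 + k\<^sup>2 * s\<^sup>2)" by simp
    have "s\<^sup>2 \<le> (sqrt y + sqrt a)\<^sup>2" using s(2) by (metis abs_ge_zero power2_abs power_mono)
    also have "\<dots> \<le> (2 * sqrt X)\<^sup>2" using a y
      by (intro power_mono) (auto intro: add_mono[of "sqrt y" "sqrt X" "sqrt a" "sqrt X", simplified])
    also have "\<dots> \<le> \<Lambda>" using a \<Lambda> by (simp add: power_mult_distrib)
    finally have "poly (bump 4 \<Lambda> j) (s\<^sup>2) \<le> (2 * \<Lambda> / (1 + k\<^sup>2 * s\<^sup>2)) ^ 4"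
      unfolding k_def using \<Lambda> by (intro bump_le) auto
    \<comment> \<open>Since \<open>u\<close> grows quadratically in \<open>kd\<close>, decay in
      \<open>k\<^sup>2 s\<^sup>2\<close> becomes decay in \<open>u\<close>. The fourth power leaves
      two factors \<open>1 + u\<^sup>2\<close>, one for the kernel and one for the second moment in
      \<open>vertex_node\<close>.\<close>
    also have "\<dots> \<le> (4 * \<Lambda> / (1 + u)) ^ 4"
    proof (intro power_mono)
      have "0 < 1 + k\<^sup>2 * s\<^sup>2" by (intro add_pos_nonneg) auto
      moreover have "2 * \<Lambda> * (1 + u) \<le> 2 * \<Lambda> * (2 * (1 + k\<^sup>2 * s\<^sup>2))" using us \<Lambda> by (intro mult_left_mono) auto
      ultimately show "2 * \<Lambda> / (1 + k\<^sup>2 * s\<^sup>2) \<le> 4 * \<Lambda> / (1 + u)"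
        using u0 by (simp add: field_simps)
    qed (use \<Lambda> in \<open>auto intro: add_nonneg_nonneg\<close>)
    finally have "poly (bump 4 \<Lambda> j) (s\<^sup>2) * (1 + u) ^ 4 \<le> (4 * \<Lambda>) ^ 4"
      using u0 by (simp add: power_divide field_simps)
    moreover have "(1 + ((y - a) / \<sigma>)\<^sup>2)\<^sup>2 \<le> (1 + u) ^ 4"
    proof -
      have "((y - a) / \<sigma>)\<^sup>2 = u\<^sup>2" by (simp add: u_def power_divide)
      moreover have "1 + u\<^sup>2 \<le> (1 + u)\<^sup>2" using u0 by (simp add: power2_sum)
      then have "(1 + u\<^sup>2)\<^sup>2 \<le> ((1 + u)\<^sup>2)\<^sup>2" by (intro power_mono) auto
      ultimately show ?thesis by simp
    qed
    ultimately show ?thesis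
      using bump_nonneg[of 4 \<Lambda> j "s\<^sup>2"] by (meson mult_left_mono order_trans)
  qed
  show ?thesis
  proof
    show "degree g \<le> 8 * j" using g(1) degree_bump[of 4 \<Lambda> j] by simp
    show "0 \<le> poly g y" if "0 \<le> y" for y using g(2)[OF that] by (simp add: bump_nonneg)
    show "poly g y * (1 + ((y - a) / \<sigma>)\<^sup>2)\<^sup>2 \<le> 2 * (4 * \<Lambda>) ^ 4" if "0 \<le> y" "y \<le> X" for y
    proof -
      have s: "0 \<le> sqrt y" "0 \<le> sqrt a" using a that by auto
      have abs: "\<bar>sqrt y - sqrt a\<bar> \<le> \<bar>sqrt y + sqrt a\<bar>" "\<bar>sqrt y - sqrt a\<bar> \<le> sqrt y + sqrt a"
        "\<bar>sqrt y + sqrt a\<bar> \<le> sqrt y + sqrt a"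
        using s by linarith+
      show ?thesis
        using bound[OF that order_refl abs(2)] bound[OF that abs(1,3)]
        unfolding g(2)[OF that(1)] distrib_right by linarith
    qed
    show "(1 / 4) ^ 4 \<le> poly g y" if y: "a \<le> y" "y \<le> a + \<sigma>" for y
    proof -
      \<comment> \<open>A step \<open>\<sigma>\<close> upwards from \<open>a\<close> moves the
        square root by at most \<open>1/k\<close>, which keeps it in the core of the unreflected
        bump.\<close>
      have "a + \<sigma> \<le> (sqrt a + 1 / k)\<^sup>2"
      proof -
        have "\<sigma> = sqrt a / k + 1 / k\<^sup>2" by (simp add: \<sigma>_def add_divide_distrib power2_eq_square)
        moreover have "(sqrt a + 1 / k)\<^sup>2 = a + 2 * (sqrt a / k) + 1 / k\<^sup>2"
          using a by (simp add: power2_sum power_divide)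
        moreover have "0 \<le> sqrt a / k" using a k by simp
        ultimately show ?thesis by linarith
      qed
      then have "sqrt y \<le> sqrt a + 1 / k"
        using y a k by (intro real_le_lsqrt) auto
      moreover have "sqrt a \<le> sqrt y" using y by simp
      ultimately have "(sqrt y - sqrt a)\<^sup>2 \<le> (1 / k)\<^sup>2" by (intro power_mono) auto
      also have "\<dots> \<le> \<Lambda> / k\<^sup>2" using \<Lambda> by (simp add: power_divide divide_right_mono)
      finally have "(1 / 4) ^ 4 \<le> poly (bump 4 \<Lambda> j) ((sqrt y - sqrt a)\<^sup>2)"
        unfolding k_def using \<Lambda> by (intro bump_ge) auto
      then show ?thesis using g(2)[of y] a y bump_nonneg[of 4 \<Lambda> j "(sqrt y + sqrt a)\<^sup>2"] by simp
    qed
  qed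
qed

lemma one_plus_sum_le_prod:
  fixes a :: "'a \<Rightarrow> real"
  assumes "finite A" "\<And>i. i \<in> A \<Longrightarrow> 0 \<le> a i"
  shows "1 + (\<Sum>i\<in>A. a i) \<le> (\<Prod>i\<in>A. 1 + a i)"
  using assms
proof (induction A rule: finite_induct)
  case (insert i A)
  have "a i * 1 \<le> a i * (\<Prod>i\<in>A. 1 + a i)"
    using insert by (intro mult_left_mono prod_ge_1) auto
  then show ?case using insert by (simp add: distrib_right)
qed simp


section \<open>From nodes near one point to a net on the polytope\<close>

context facet_metric
begin

lemma x_bounded: obtains X where "1 \<le> X" "\<And>f p. f facet_of K \<Longrightarrow> p \<in> K \<Longrightarrow> x f p \<le> X"
proof -
  have "\<exists>B. \<forall>p\<in>K. x f p \<le> B" if "f facet_of K" for f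
    using compact_imp_bounded[OF compact_continuous_image[OF continuous_on_x[OF that continuous_on_id] K_props(1)]]
    unfolding bounded_real by (meson abs_le_D1 image_eqI)
  then obtain B where B: "\<And>f p. f facet_of K \<Longrightarrow> p \<in> K \<Longrightarrow> x f p \<le> B f" by metis
  show ?thesis
  proof
    show "1 \<le> (\<Sum>f | f facet_of K. \<bar>B f\<bar>) + 1" by (simp add: sum_nonneg)
    fix f p assume f: "f facet_of K" "p \<in> K"
    have "\<bar>B f\<bar> \<le> (\<Sum>f | f facet_of K. \<bar>B f\<bar>)"
      using f finite_facets by (intro member_le_sum) auto
    then show "x f p \<le> (\<Sum>f | f facet_of K. \<bar>B f\<bar>) + 1" using B[OF f] by linarith
  qed
qed

text \<open>In the coordinates \<open>T\<close>, centred at \<open>q\<close> and scaled by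
  \<open>\<sigma>\<close>, a product of bumps has mass bounded below on the unit cube and a bounded
  second moment. The last hypothesis says that this cube lies in \<open>K\<close>.\<close>

lemma vertex_node:
  fixes \<phi> :: "'n \<Rightarrow> (real ^ 'n) set"
  assumes \<phi>: "\<And>i. \<phi> i facet_of K" and c: "0 < c" "\<And>d. c * norm d \<le> norm (\<chi> i. grad (\<phi> i) \<bullet> d)"
    and X: "1 \<le> X" "\<And>f p. f facet_of K \<Longrightarrow> p \<in> K \<Longrightarrow> x f p \<le> X"
  obtains R where "1 \<le> R"
    "\<And>t F w j q. cubature_formula K t F w \<Longrightarrow> positive_formula F w \<Longrightarrow> F \<subseteq> K \<Longrightarrow> q \<in> K \<Longrightarrow>
      CARD('n) * (8 * j) + 2 \<le> t \<Longrightarrow>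
      (\<And>p. (\<And>i. x (\<phi> i) q \<le> x (\<phi> i) p \<and>
          x (\<phi> i) p \<le> x (\<phi> i) q + (sqrt (x (\<phi> i) q) + 1 / real (2 * j + 1)) / real (2 * j + 1)) \<Longrightarrow> p \<in> K) \<Longrightarrow>
      \<exists>p\<in>F. \<forall>i. \<bar>x (\<phi> i) p - x (\<phi> i) q\<bar> \<le> R * ((sqrt (x (\<phi> i) q) + 1 / real (2 * j + 1)) / real (2 * j + 1))"
proof -
  define \<Lambda> where "\<Lambda> = 4 * X"
  define B where "B = 2 * (4 * \<Lambda>) ^ 4"
  define J where "J = (\<integral>u. cauchy_kernel u \<partial>(lborel :: (real ^ 'n) measure))"
  have J: "0 \<le> J" unfolding J_def by (intro integral_nonneg_AE) (simp add: cauchy_kernel_pos less_imp_le)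
  have \<Lambda>: "1 \<le> \<Lambda>" "4 * X \<le> \<Lambda>" using X by (auto simp: \<Lambda>_def)
  have B: "0 \<le> B" using X by (simp add: B_def \<Lambda>_def)
  \<comment> \<open>The quotient of the upper bound for the integral of \<open>G Q\<close> by the
    lower bound for that of \<open>G\<close>, plus 1. The Jacobian factor \<open>D\<close>, the only
    dependence on \<open>q\<close> and \<open>j\<close>, cancels; \<open>256\<close> is
    \<open>4 ^ 4\<close>.\<close>
  define R where "R = B ^ CARD('n) * J * 256 ^ CARD('n) + 1"
  have R: "1 \<le> R" using B J by (simp add: R_def)
  show ?thesis
  proof
    \<comment> \<open>The root appears because \<open>Q\<close> bounds the squares of the scaled
      coordinates.\<close>
    show "1 \<le> sqrt R" using R by simp
    fix t F w j q
    assume cub: "cubature_formula K t F w" "positive_formula F w" "F \<subseteq> K" and q: "q \<in> K"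
      and deg: "CARD('n) * (8 * j) + 2 \<le> t"
      and box: "\<And>p. (\<And>i. x (\<phi> i) q \<le> x (\<phi> i) p \<and>
          x (\<phi> i) p \<le> x (\<phi> i) q + (sqrt (x (\<phi> i) q) + 1 / real (2 * j + 1)) / real (2 * j + 1)) \<Longrightarrow> p \<in> K"
    define a where "a i = x (\<phi> i) q" for i
    define \<sigma> where "\<sigma> i = (sqrt (a i) + 1 / real (2 * j + 1)) / real (2 * j + 1)" for i
    have a: "0 \<le> a i" "a i \<le> X" for i using x_nonneg X q \<phi> by (auto simp: a_def)
    have \<sigma>: "0 < \<sigma> i" for i
      unfolding \<sigma>_def using a by (intro divide_pos_pos add_nonneg_pos) auto
    have "\<exists>g :: real poly. degree g \<le> 8 * j \<and> (\<forall>y\<ge>0. 0 \<le> poly g y) \<and>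
      (\<forall>y. 0 \<le> y \<longrightarrow> y \<le> X \<longrightarrow> poly g y * (1 + ((y - a i) / \<sigma> i)\<^sup>2)\<^sup>2 \<le> B) \<and>
      (\<forall>y. a i \<le> y \<longrightarrow> y \<le> a i + \<sigma> i \<longrightarrow> (1 / 4) ^ 4 \<le> poly g y)" for i
      using sqrt_bump[OF a(1)[of i] a(2)[of i] \<Lambda>, of j] unfolding \<sigma>_def B_def by metis
    then obtain g :: "'n \<Rightarrow> real poly" where g: "\<And>i. degree (g i) \<le> 8 * j" "\<And>i y. 0 \<le> y \<Longrightarrow> 0 \<le> poly (g i) y"
      "\<And>i y. 0 \<le> y \<Longrightarrow> y \<le> X \<Longrightarrow> poly (g i) y * (1 + ((y - a i) / \<sigma> i)\<^sup>2)\<^sup>2 \<le> B"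
      "\<And>i y. a i \<le> y \<Longrightarrow> y \<le> a i + \<sigma> i \<Longrightarrow> (1 / 4) ^ 4 \<le> poly (g i) y"
      by metis
    define T where "T p = (\<chi> i. (x (\<phi> i) p - a i) / \<sigma> i)" for p
    define L where "L p = (\<chi> i. (grad (\<phi> i) \<bullet> p) / \<sigma> i)" for p
    have lin: "linear L"
      by (rule linearI) (auto simp: L_def vec_eq_iff inner_add_right add_divide_distrib)
    have inj: "inj L"
    proof (subst linear_injective_0[OF lin], intro allI impI)
      fix d assume "L d = 0"
      then have "grad (\<phi> i) \<bullet> d = 0" for i using \<sigma>[of i] by (auto simp: L_def vec_eq_iff dest: spec[of _ i])
      then have "(\<chi> i. grad (\<phi> i) \<bullet> d) = 0" by (simp add: vec_eq_iff)
      then show "d = 0" using c(1) c(2)[of d] by (simp add: mult_le_0_iff)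
    qed
    have T: "T p = L p + (\<chi> i. (x (\<phi> i) 0 - a i) / \<sigma> i)" for p
      using x_affine[OF \<phi>, of _ p] by (simp add: T_def L_def vec_eq_iff add_divide_distrib diff_divide_distrib)
    obtain D where D: "0 < D"
      "\<And>f :: real ^ 'n \<Rightarrow> real. integrable lborel f \<Longrightarrow> (\<And>u. 0 \<le> f u) \<Longrightarrow> f \<in> borel_measurable borel \<Longrightarrow>
         integrable lborel (\<lambda>p. f (T p)) \<and> (\<integral>p. f (T p) \<partial>lborel) = D * (\<integral>u. f u \<partial>lborel)"
      using integral_affine_bij[OF lin inj T] by blast
    define G where "G p = (\<Prod>i\<in>UNIV. poly (g i) (x (\<phi> i) p))" for p
    define Q where "Q p = (\<Sum>i\<in>UNIV. (T p $ i)\<^sup>2)" for p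
    have degG: "poly_degree_le (CARD('n) * (8 * j)) G"
    proof -
      have "G p = (\<Prod>i\<in>UNIV. poly (g i) (grad (\<phi> i) \<bullet> p + x (\<phi> i) 0))" for p
        unfolding G_def by (intro prod.cong refl arg_cong[of _ _ "poly _"] x_affine \<phi>)
      then have "G = (\<lambda>p. \<Prod>i\<in>UNIV. poly (g i) (grad (\<phi> i) \<bullet> p + x (\<phi> i) 0))" by (rule ext)
      then show ?thesis
        by (simp only:) (intro poly_degree_le_prod poly_degree_le_poly_affine g(1))
    qed
    have degQ: "poly_degree_le 2 Q"
    proof -
      have "T p $ i = (1 / \<sigma> i) * (grad (\<phi> i) \<bullet> p + (x (\<phi> i) 0 - a i))" for p i
        using x_affine[OF \<phi>, of i p] by (simp add: T_def)
      then have "Q = (\<lambda>p. \<Sum>i\<in>UNIV. ((1 / \<sigma> i) * (grad (\<phi> i) \<bullet> p + (x (\<phi> i) 0 - a i)))\<^sup>2)"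
        by (simp only: Q_def[abs_def])
      moreover have "poly_degree_le (1 * 2) (\<lambda>p. \<Sum>i\<in>UNIV. ((1 / \<sigma> i) * (grad (\<phi> i) \<bullet> p + (x (\<phi> i) 0 - a i)))\<^sup>2)"
        by (intro poly_degree_le_sum poly_degree_le_power poly_degree_le_cmult poly_degree_le_affine)
      ultimately show ?thesis by simp
    qed
    note cont = continuous_on_poly_degree_le[OF degG] continuous_on_poly_degree_le[OF degQ]
    have G0: "0 \<le> G p" if "p \<in> K" for p
      unfolding G_def using g(2) x_nonneg[OF \<phi> that] by (intro prod_nonneg) auto
    have GQ: "G p * Q p \<le> B ^ CARD('n) * cauchy_kernel (T p)" if p: "p \<in> K" for p
    proof -
      \<comment> \<open>The bumps give \<open>G H\<^sup>2 \<le> B ^ n\<close>. One factor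
        \<open>H\<close> absorbs \<open>Q\<close>, the other is the reciprocal of the
        kernel.\<close>
      define H where "H = (\<Prod>i\<in>UNIV. 1 + (T p $ i)\<^sup>2)"
      have H1: "1 \<le> H" unfolding H_def by (intro prod_ge_1) auto
      have HK: "cauchy_kernel (T p) = 1 / H" by (simp add: cauchy_kernel_def H_def prod_dividef)
      have "G p * H\<^sup>2 = (\<Prod>i\<in>UNIV. poly (g i) (x (\<phi> i) p) * (1 + (T p $ i)\<^sup>2)\<^sup>2)"
        by (simp add: G_def H_def prod.distrib prod_power_distrib)
      also have "\<dots> \<le> (\<Prod>i\<in>(UNIV :: 'n set). B)"
        using g(2,3) x_nonneg[OF \<phi> p] X(2)[OF \<phi> p] by (intro prod_mono) (auto simp: T_def)
      finally have GH: "G p * H\<^sup>2 \<le> B ^ CARD('n)" by simp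
      have "Q p \<le> H"
        using one_plus_sum_le_prod[of UNIV "\<lambda>i. (T p $ i)\<^sup>2"] by (simp add: Q_def H_def)
      then have "G p * Q p \<le> G p * H" using G0[OF p] by (intro mult_left_mono)
      also have "\<dots> = G p * H\<^sup>2 / H" using H1 by (simp add: power2_eq_square)
      also have "\<dots> \<le> B ^ CARD('n) / H" using GH H1 by (intro divide_right_mono) auto
      finally show ?thesis by (simp add: HK)
    qed
    have kern: "integrable lborel (\<lambda>p. B ^ CARD('n) * cauchy_kernel (T p))"
      "(\<integral>p. B ^ CARD('n) * cauchy_kernel (T p) \<partial>lborel) = B ^ CARD('n) * (D * J)"
      using D(2)[OF integrable_cauchy_kernel less_imp_le[OF cauchy_kernel_pos] borel_measurable_cauchy_kernel]
      by (auto simp: J_def)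
    have up: "(\<integral>p. indicator K p * (G p * Q p) \<partial>lborel) \<le> B ^ CARD('n) * (D * J)"
      unfolding kern(2)[symmetric] using GQ B
      by (intro integral_indicator_le K_props kern(1) continuous_intros cont) (auto simp: cauchy_kernel_pos less_imp_le)
    define E where "E = cbox 0 (One :: real ^ 'n)"
    have memE: "u \<in> E \<longleftrightarrow> (\<forall>i. 0 \<le> u $ i \<and> u $ i \<le> 1)" for u
    proof -
      have "u \<in> E \<longleftrightarrow> (\<forall>b\<in>Basis. 0 \<le> u \<bullet> b \<and> u \<bullet> b \<le> 1)" by (simp add: E_def mem_box)
      also have "\<dots> \<longleftrightarrow> (\<forall>i. 0 \<le> u $ i \<and> u $ i \<le> 1)" by (simp add: Basis_vec_def inner_axis)
      finally show ?thesis .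
    qed
    define S where "S = T -` E"
    have "continuous_on UNIV T"
      unfolding T using linear_continuous_on[of L UNIV] lin by (intro continuous_intros) (simp add: linear_conv_bounded_linear)
    then have "closed S" unfolding S_def E_def by (intro continuous_closed_vimage) (auto simp: continuous_on_eq_continuous_at)
    have "measure lborel S = (\<integral>p. indicator E (T p) \<partial>lborel)"
      using \<open>closed S\<close> by (subst Bochner_Integration.integral_cong[OF refl, of _ _ "indicator S"]) (auto simp: S_def indicator_def)
    also have "\<dots> = D * measure lborel E"
      using D(2)[of "indicator E"] by (simp add: E_def)
    also have "measure lborel E = 1" by (simp add: E_def inner_diff_left)
    finally have mS: "measure lborel S = D" by simp
    have Sx: "a i \<le> x (\<phi> i) p \<and> x (\<phi> i) p \<le> a i + \<sigma> i" if "p \<in> S" for p i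
    proof -
      have "0 \<le> (x (\<phi> i) p - a i) / \<sigma> i" "(x (\<phi> i) p - a i) / \<sigma> i \<le> 1"
        using that by (auto simp: S_def memE T_def)
      then show ?thesis using \<sigma>[of i] by (simp add: field_simps zero_le_divide_iff)
    qed
    then have SK: "S \<subseteq> K" using box by (auto simp: a_def \<sigma>_def)
    have low: "((1 / 4) ^ 4) ^ CARD('n) * measure lborel S \<le> (\<integral>p. indicator K p * G p \<partial>lborel)"
    proof (rule measure_le_integral_indicator[OF K_props(1) cont(1) SK])
      fix p assume p: "p \<in> S"
      have "(\<Prod>i\<in>(UNIV :: 'n set). (1 / 4) ^ 4) \<le> G p"
        unfolding G_def using g(4) Sx[OF p] by (intro prod_mono) auto
      then show "((1 / 4) ^ 4) ^ CARD('n) \<le> G p" by simp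
    qed (use \<open>closed S\<close> G0 in auto)
    have "B ^ CARD('n) * (D * J) < R * (((1 / 4) ^ 4) ^ CARD('n) * D)"
      using D(1) by (simp add: R_def field_simps power_divide)
    also have "\<dots> \<le> R * (\<integral>p. indicator K p * G p \<partial>lborel)"
      using low R by (intro mult_left_mono) (auto simp: mS)
    finally have "(\<integral>p. indicator K p * (G p * Q p) \<partial>lborel) < R * (\<integral>p. indicator K p * G p \<partial>lborel)"
      using up by linarith
    then obtain p where p: "p \<in> F" "0 < G p * (R - Q p)"
      using cubature_formula_node[OF cub(1,2) K_props(1,5) degG degQ deg] by blast
    \<comment> \<open>\<open>G\<close> is known to be nonnegative only where the coordinates are, so
      the assumption that the nodes lie in \<open>K\<close> is used here.\<close>
    then have "Q p < R" using G0[of p] cub(3) by (auto simp: zero_less_mult_iff)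
    have "\<bar>x (\<phi> i) p - a i\<bar> \<le> sqrt R * \<sigma> i" for i
    proof -
      have "(T p $ i)\<^sup>2 \<le> Q p" unfolding Q_def by (rule member_le_sum) auto
      then have "(T p $ i)\<^sup>2 \<le> R" using \<open>Q p < R\<close> by linarith
      then have "\<bar>T p $ i\<bar> \<le> sqrt R" using real_sqrt_le_mono by fastforce
      then show ?thesis using \<sigma>[of i] by (simp add: T_def field_simps)
    qed
    then show "\<exists>p\<in>F. \<forall>i. \<bar>x (\<phi> i) p - x (\<phi> i) q\<bar> \<le> sqrt R * ((sqrt (x (\<phi> i) q) + 1 / real (2 * j + 1)) / real (2 * j + 1))"
      using p(1) by (auto simp: a_def \<sigma>_def)
  qed
qed

text \<open>Facets through the chosen vertex are controlled by \<open>vertex_node\<close> and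
  \<open>sqrt_close\<close>. All others have functions at least \<open>\<eta>\<close> near
  \<open>q0\<close>, where the square root is Lipschitz, so the Euclidean estimate
  \<open>near\<close> suffices.\<close>

lemma local_net:
  assumes simple: "simple_polytope K" and q0: "q0 \<in> K"
  obtains e C t0 where "0 < e" "0 < C"
    "\<And>t F w q. t0 \<le> t \<Longrightarrow> cubature_formula K t F w \<Longrightarrow> positive_formula F w \<Longrightarrow> F \<subseteq> K \<Longrightarrow>
       q \<in> K \<Longrightarrow> norm (q - q0) < e \<Longrightarrow> \<exists>p\<in>F. sqrt_dist q p \<le> C / real t"
proof -
  obtain v where v: "v extreme_point_of K" "\<And>f. f facet_of K \<Longrightarrow> v \<notin> f \<Longrightarrow> 0 < x f q0"
    using nearby_vertex[OF q0] by blast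
  obtain \<phi> :: "'n \<Rightarrow> (real ^ 'n) set" and c where \<phi>r: "\<phi> ` UNIV = {f. f facet_of K \<and> v \<in> f}"
    and c: "0 < c" "\<And>d. c * norm d \<le> norm (\<chi> i. grad (\<phi> i) \<bullet> d)"
    using vertex_coordinates[OF simple v(1)] by blast
  have \<phi>: "\<phi> i facet_of K" for i using \<phi>r by blast
  obtain X where X: "1 \<le> X" "\<And>f p. f facet_of K \<Longrightarrow> p \<in> K \<Longrightarrow> x f p \<le> X" using x_bounded by blast
  define \<sigma> where "\<sigma> j q i = (sqrt (x (\<phi> i) q) + 1 / real (2 * j + 1)) / real (2 * j + 1)" for j q i
  obtain R where R: "1 \<le> R" and node:
    "\<And>t F w j q. cubature_formula K t F w \<Longrightarrow> positive_formula F w \<Longrightarrow> F \<subseteq> K \<Longrightarrow> q \<in> K \<Longrightarrow>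
      CARD('n) * (8 * j) + 2 \<le> t \<Longrightarrow>
      (\<And>p. (\<And>i. x (\<phi> i) q \<le> x (\<phi> i) p \<and> x (\<phi> i) p \<le> x (\<phi> i) q + \<sigma> j q i) \<Longrightarrow> p \<in> K) \<Longrightarrow>
      \<exists>p\<in>F. \<forall>i. \<bar>x (\<phi> i) p - x (\<phi> i) q\<bar> \<le> R * \<sigma> j q i"
    using vertex_node[OF \<phi> c X] unfolding \<sigma>_def by blast
  obtain e \<eta> where e: "0 < e" "0 < \<eta>"
    "\<And>f q. f \<in> {f. f facet_of K \<and> v \<notin> f} \<Longrightarrow> norm (q - q0) < e \<Longrightarrow> \<eta> \<le> x f q"
    using x_pos_neighbourhood[of "{f. f facet_of K \<and> v \<notin> f}" q0] v(2) by blast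
  define n where "n = real CARD('n)"
  have n: "1 \<le> n" unfolding n_def using zero_less_card_finite[where 'a = 'n] by linarith
  define W where "W = sqrt X + 1"
  have W: "0 < W" using X by (simp add: W_def add_nonneg_pos)
  have \<sigma>_le: "\<sigma> j q i \<le> W / real (2 * j + 1)" if "q \<in> K" for j q i
    unfolding \<sigma>_def W_def using X(2)[OF \<phi> that, of i]
    by (intro divide_right_mono add_mono) auto
  have near: "norm (p - q) \<le> n * (r * W) / (c * real (2 * j + 1))"
    if "q \<in> K" "0 \<le> r" "\<And>i. \<bar>x (\<phi> i) p - x (\<phi> i) q\<bar> \<le> r * \<sigma> j q i" for p q r j
  proof -
    have "c * norm (p - q) \<le> norm (\<chi> i. grad (\<phi> i) \<bullet> (p - q))" by (rule c)
    also have "\<dots> \<le> (\<Sum>i\<in>UNIV. \<bar>grad (\<phi> i) \<bullet> (p - q)\<bar>)"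
      using norm_le_l1_cart[of "\<chi> i. grad (\<phi> i) \<bullet> (p - q)"] by simp
    also have "\<dots> \<le> (\<Sum>i\<in>(UNIV :: 'n set). r * (W / real (2 * j + 1)))"
      using that \<sigma>_le[OF that(1)] x_diff[OF \<phi>] by (intro sum_mono) (metis mult_left_mono order_trans)
    also have "\<dots> = n * (r * W) / real (2 * j + 1)" by (simp add: n_def)
    finally have "norm (p - q) \<le> n * (r * W) / real (2 * j + 1) / c"
      using c(1) by (simp only: pos_le_divide_eq mult.commute)
    then show ?thesis by (simp add: mult.commute)
  qed
  define C1 where "C1 = 2 * R + lip * (n * (R * W) / c) / sqrt \<eta>"
  have C1: "0 \<le> C1" unfolding C1_def using R lip_pos n W c(1) e(2)
    by (intro add_nonneg_nonneg divide_nonneg_nonneg mult_nonneg_nonneg) auto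
  define N where "N = real (card {f. f facet_of K})"
  \<comment> \<open>Large enough that the coordinate box at \<open>q\<close> has Euclidean radius
    below \<open>e / 2\<close>. Together with \<open>q\<close> within \<open>e / 2\<close> of
    \<open>q0\<close> this keeps the box in the ball of radius \<open>e\<close>.\<close>
  define t0 where "t0 = nat \<lceil>10 * n * (2 * n * W / (c * e))\<rceil> + 3"
  show ?thesis
  proof
    show "0 < e / 2" using e by simp
    show "0 < N * (2 * C1) * (10 * n) + 1"
      using C1 n by (intro add_nonneg_pos mult_nonneg_nonneg) (auto simp: N_def)
    fix t F w q
    assume t: "t0 \<le> t" and cub: "cubature_formula K t F w" "positive_formula F w" "F \<subseteq> K"
      and q: "q \<in> K" "norm (q - q0) < e / 2"
    \<comment> \<open>The largest \<open>j\<close> with \<open>8nj + 2 \<le> t\<close>: degree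
      \<open>8j\<close> per coordinate, and 2 for the quadratic factor.\<close>
    define j where "j = (t - 2) div (8 * CARD('n))"
    define k where "k = real (2 * j + 1)"
    have k: "1 \<le> k" by (simp add: k_def)
    have t2: "3 \<le> t" using t by (simp add: t0_def)
    have deg: "CARD('n) * (8 * j) + 2 \<le> t"
      using t2 times_div_less_eq_dividend[of "8 * CARD('n)" "t - 2"] unfolding j_def by (simp add: mult_ac)
    have "t - 2 < 8 * CARD('n) * (j + 1)"
      unfolding j_def using dividend_less_times_div[of "8 * CARD('n)" "t - 2"] by simp
    then have "t \<le> 8 * CARD('n) * (j + 1) + 1" by simp
    also have "\<dots> \<le> 10 * CARD('n) * (2 * j + 1)"
      using zero_less_card_finite[where 'a = 'n] by (simp add: distrib_left Suc_le_eq)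
    finally have "real t \<le> real (10 * CARD('n) * (2 * j + 1))" by (rule of_nat_mono)
    then have tk: "real t \<le> 10 * n * k" by (simp add: n_def k_def distrib_left)
    have "10 * n * (2 * n * W / (c * e)) < real t"
      using t unfolding t0_def by linarith
    then have "10 * n * (2 * n * W / (c * e)) < 10 * n * k" using tk by linarith
    then have "2 * n * W / (c * e) < k" by (rule mult_left_less_imp_less) (use n in simp)
    then have small: "n * (1 * W) / (c * k) < e / 2"
      using c(1) e(1) k by (simp add: field_simps)
    \<comment> \<open>Only the lower side of the box is needed for facets through \<open>v\<close>;
      its upper side keeps \<open>p\<close> close to \<open>q0\<close>, where the other facet
      functions stay positive.\<close>
    have box: "p \<in> K" if p: "\<And>i. x (\<phi> i) q \<le> x (\<phi> i) p \<and> x (\<phi> i) p \<le> x (\<phi> i) q + \<sigma> j q i" for p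
      unfolding mem_K_iff
    proof (intro allI impI)
      fix f assume f: "f facet_of K"
      show "0 \<le> x f p"
      proof (cases "v \<in> f")
        case True
        then obtain i where "f = \<phi> i" using f \<phi>r by blast
        then show ?thesis using p[of i] x_nonneg[OF f q(1)] by simp
      next
        case False
        have "\<bar>x (\<phi> i) p - x (\<phi> i) q\<bar> \<le> 1 * \<sigma> j q i" for i using p[of i] by simp
        then have "norm (p - q) \<le> n * (1 * W) / (c * k)"
          unfolding k_def by (intro near q) auto
        then have "norm (p - q) < e / 2" using small by linarith
        then have "norm (p - q0) < e" using q(2) norm_triangle_ineq[of "p - q" "q - q0"] by simp
        then show ?thesis using e(2) e(3)[of f p] f False by simp
      qed
    qed
    then obtain p where p: "p \<in> F" "\<And>i. \<bar>x (\<phi> i) p - x (\<phi> i) q\<bar> \<le> R * \<sigma> j q i"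
      using node[OF cub q(1) deg] by blast
    have pK: "p \<in> K" using p cub(3) by blast
    have "\<bar>sqrt (x f q) - sqrt (x f p)\<bar> \<le> C1 / k" if f: "f facet_of K" for f
    proof (cases "v \<in> f")
      case True
      then obtain i where i: "f = \<phi> i" using f \<phi>r by blast
      have "\<bar>sqrt (x f p) - sqrt (x f q)\<bar> \<le> 2 * R / k"
        using p(2)[of i] x_nonneg[OF f] pK q(1) k R unfolding i \<sigma>_def k_def[symmetric]
        by (intro sqrt_close) auto
      also have "\<dots> \<le> C1 / k"
        using k lip_pos n R W c(1) e(2) by (intro divide_right_mono) (auto simp: C1_def)
      finally show ?thesis by (simp add: abs_minus_commute)
    next
      case False
      have \<eta>: "\<eta> \<le> x f q" using e(3)[of f q] q(2) f False e(1) by simp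
      have pos: "0 < sqrt \<eta>" "sqrt \<eta> \<le> sqrt (x f q)" "0 \<le> sqrt (x f p)"
        using \<eta> e(2) x_nonneg[OF f pK] by auto
      have "\<bar>sqrt (x f q) - sqrt (x f p)\<bar> * sqrt \<eta> \<le> \<bar>sqrt (x f q) - sqrt (x f p)\<bar> * (sqrt (x f q) + sqrt (x f p))"
        using pos by (intro mult_left_mono; linarith)
      also have "\<dots> = \<bar>(sqrt (x f q) - sqrt (x f p)) * (sqrt (x f q) + sqrt (x f p))\<bar>"
        using pos by (simp add: abs_mult)
      also have "(sqrt (x f q) - sqrt (x f p)) * (sqrt (x f q) + sqrt (x f p)) = x f q - x f p"
        using x_nonneg[OF f pK] x_nonneg[OF f q(1)] by (simp add: algebra_simps)
      also have "\<bar>x f q - x f p\<bar> \<le> lip * norm (p - q)"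
        using x_lipschitz[OF f, of q p] by (simp add: norm_minus_commute)
      also have "\<dots> \<le> lip * (n * (R * W) / (c * k))"
        using near[OF q(1) _ p(2)] R lip_pos unfolding k_def by (intro mult_left_mono) auto
      finally have "\<bar>sqrt (x f q) - sqrt (x f p)\<bar> \<le> lip * (n * (R * W) / (c * k)) / sqrt \<eta>"
        using pos(1) by (simp only: pos_le_divide_eq)
      also have "\<dots> = lip * (n * (R * W) / c) / sqrt \<eta> / k" by simp
      also have "\<dots> \<le> C1 / k" using k R by (intro divide_right_mono) (auto simp: C1_def)
      finally show ?thesis .
    qed
    then have "sqrt_dist q p \<le> (\<Sum>f | f facet_of K. 2 * (C1 / k))"
      unfolding sqrt_dist_def by (intro sum_mono mult_left_mono) simp_all
    also have "\<dots> = N * (2 * C1) / k" by (simp add: N_def)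
    also have "\<dots> \<le> N * (2 * C1) / (real t / (10 * n))"
      using tk t2 n k C1 by (intro divide_left_mono) (auto simp: N_def field_simps)
    also have "\<dots> = N * (2 * C1) * (10 * n) / real t" by simp
    also have "\<dots> \<le> (N * (2 * C1) * (10 * n) + 1) / real t" by (intro divide_right_mono) auto
    finally show "\<exists>p\<in>F. sqrt_dist q p \<le> (N * (2 * C1) * (10 * n) + 1) / real t" using p(1) by blast
  qed
qed

text \<open>A finite cover by the neighbourhoods of \<open>local_net\<close> makes its constants
  uniform for large \<open>t\<close>. For the remaining \<open>t\<close> any node will do, since
  \<open>sqrt_dist\<close> is bounded on \<open>K\<close>, and there is a node because the weights
  sum to 1.\<close>

lemma cubature_net:
  assumes "simple_polytope K"
  obtains C where "0 < C"
    "\<And>t F w q. 1 \<le> t \<Longrightarrow> cubature_formula K t F w \<Longrightarrow> positive_formula F w \<Longrightarrow> F \<subseteq> K \<Longrightarrow> q \<in> K \<Longrightarrow>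
       \<exists>p\<in>F. path_dist K x q p \<le> C / real t"
proof -
  have "\<exists>e C t0. 0 < e \<and> 0 < C \<and> (\<forall>t F w q. t0 \<le> t \<longrightarrow> cubature_formula K t F w \<longrightarrow> positive_formula F w \<longrightarrow>
      F \<subseteq> K \<longrightarrow> q \<in> K \<longrightarrow> norm (q - q0) < e \<longrightarrow> (\<exists>p\<in>F. sqrt_dist q p \<le> C / real t))" if "q0 \<in> K" for q0
    by (rule local_net[OF assms that]) metis
  then obtain e C t0 where loc: "\<And>q0. q0 \<in> K \<Longrightarrow> 0 < e q0" "\<And>q0. q0 \<in> K \<Longrightarrow> 0 < C q0"
    "\<And>q0 t F w q. q0 \<in> K \<Longrightarrow> t0 q0 \<le> t \<Longrightarrow> cubature_formula K t F w \<Longrightarrow> positive_formula F w \<Longrightarrow>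
      F \<subseteq> K \<Longrightarrow> q \<in> K \<Longrightarrow> norm (q - q0) < e q0 \<Longrightarrow> \<exists>p\<in>F. sqrt_dist q p \<le> C q0 / real t"
    by metis
  have "K \<subseteq> (\<Union>q0\<in>K. ball q0 (e q0))" using loc(1) by force
  then obtain A where A: "A \<subseteq> K" "finite A" "K \<subseteq> (\<Union>q0\<in>A. ball q0 (e q0))"
    by (rule compactE_image[OF K_props(1) open_ball])
  have "bounded ((\<lambda>z. sqrt_dist (fst z) (snd z)) ` (K \<times> K))"
    using K_props(1) by (intro compact_imp_bounded compact_continuous_image continuous_on_sqrt_dist compact_Times)
  then obtain M where M: "\<And>p q. p \<in> K \<Longrightarrow> q \<in> K \<Longrightarrow> \<bar>sqrt_dist p q\<bar> \<le> M"
    unfolding bounded_real by auto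
  obtain z where "z \<in> K" using K_props(3) interior_subset by fastforce
  then have M0: "0 \<le> M" using M[of z z] by simp
  \<comment> \<open>The first sum dominates every local constant; the second summand gives
    \<open>M \<le> C' / t\<close> whenever \<open>t\<close> lies below one of the
    thresholds.\<close>
  define C' where "C' = (\<Sum>a\<in>A. C a) + M * real (\<Sum>a\<in>A. t0 a) + 1"
  have CA: "C a \<le> (\<Sum>a\<in>A. C a)" if "a \<in> A" for a
    using that A loc(2) by (intro member_le_sum) (auto intro: less_imp_le)
  have C0: "0 \<le> (\<Sum>a\<in>A. C a)" using A loc(2) by (intro sum_nonneg) (auto intro: less_imp_le)
  show ?thesis
  proof
    show "0 < C'" unfolding C'_def using C0 M0 by (intro add_nonneg_pos add_nonneg_nonneg mult_nonneg_nonneg) (auto intro: sum_nonneg)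
    fix t F w q
    assume t: "1 \<le> t" and cub: "cubature_formula K t F w" "positive_formula F w" "F \<subseteq> K" and q: "q \<in> K"
    obtain a where a: "a \<in> A" "norm (q - a) < e a"
      using A(3) q by (auto simp: dist_norm norm_minus_commute)
    have "\<exists>p\<in>F. sqrt_dist q p \<le> C' / real t"
    proof (cases "t0 a \<le> t")
      case True
      then obtain p where p: "p \<in> F" "sqrt_dist q p \<le> C a / real t"
        using loc(3)[OF _ True cub q a(2)] a(1) A(1) by blast
      have "C a \<le> C'" using CA[OF a(1)] mult_nonneg_nonneg[OF M0 of_nat_0_le_iff[of "\<Sum>a\<in>A. t0 a"]]
        unfolding C'_def by linarith
      then have "C a / real t \<le> C' / real t" by (intro divide_right_mono) auto
      then show ?thesis using p by force
    next
      case False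
      have "F \<noteq> {}" using cubature_formula_sum_weights[OF cub(1) K_props(1,5)] by auto
      then obtain p where p: "p \<in> F" by blast
      have "t0 a \<le> (\<Sum>a\<in>A. t0 a)" using a A by (intro member_le_sum) auto
      with False have "real t \<le> real (\<Sum>a\<in>A. t0 a)" by linarith
      then have "M * real t \<le> C'"
        unfolding C'_def using M0 C0 by (intro add_increasing2 add_increasing mult_left_mono) auto
      then have "M \<le> C' / real t" using t by (simp add: field_simps)
      then show ?thesis using p M[OF q, of p] cub(3) by (intro bexI[of _ p]) auto
    qed
    then show "\<exists>p\<in>F. path_dist K x q p \<le> C' / real t"
      using path_dist_le_sqrt_dist[OF q] cub(3) by (meson order_trans subsetD)
  qed
qed

end

theorem mainTheorem12:
  fixes K :: "(real ^ 'n) set"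
  assumes "polytope K" and "aff_dim K = int CARD('n)"
  shows
    "(simple_polytope K \<longrightarrow>
        (\<forall>x. facet_functions K x \<longrightarrow>
          (\<exists>C>0. \<forall>t\<ge>1. \<forall>F w.
             cubature_formula K t F w \<and>
             (positive_formula F w \<and> interior_formula K F \<or>
              positive_formula F w \<and> boundary_formula K F) \<longrightarrow>
             epsilon_net K x (C / real t) F))) \<and>
     (\<exists>C>0. \<forall>t\<ge>1. \<forall>F w.
        cubature_formula K t F w \<and> positive_formula F w \<longrightarrow>
        Min (w ` F) \<le> C / real t ^ (2 * CARD('n))) \<and>
     (\<exists>c>0. \<forall>t\<ge>1. \<forall>F w.
        design K t F w \<longrightarrow> real (card F) \<ge> c * real t ^ (2 * CARD('n)))"
proof (intro conjI impI allI)
  note K = polytope_full_dim[OF assms]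
  obtain C where C: "0 < C" and least: "\<And>t F w. 1 \<le> t \<Longrightarrow> cubature_formula K t F w \<Longrightarrow>
      positive_formula F w \<Longrightarrow> \<exists>p\<in>F. w p \<le> C / real t ^ (2 * CARD('n))"
    using least_weight_bound[OF assms] by blast
  show "\<exists>C>0. \<forall>t\<ge>1. \<forall>F w. cubature_formula K t F w \<and> positive_formula F w \<longrightarrow>
        Min (w ` F) \<le> C / real t ^ (2 * CARD('n))"
  proof (intro exI[of _ C] conjI C allI impI)
    fix t F w assume t: "1 \<le> t" and cub: "cubature_formula K t F w \<and> positive_formula F w"
    then obtain p where "p \<in> F" "w p \<le> C / real t ^ (2 * CARD('n))" using least by blast
    moreover have "finite F" using cub by (simp add: cubature_formula_def)
    then have "Min (w ` F) \<le> w p" using \<open>p \<in> F\<close> by (intro Min_le) auto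
    ultimately show "Min (w ` F) \<le> C / real t ^ (2 * CARD('n))" by linarith
  qed
  show "\<exists>c>0. \<forall>t\<ge>1. \<forall>F w. design K t F w \<longrightarrow> real (card F) \<ge> c * real t ^ (2 * CARD('n))"
  proof (intro exI[of _ "1 / C"] conjI allI impI)
    fix t F w assume t: "1 \<le> t" and "design K t F w"
    then have cub: "cubature_formula K t F w" and eq: "\<forall>p\<in>F. \<forall>q\<in>F. w p = w q"
      unfolding design_def by blast+
    \<comment> \<open>Exactness on the constant 1 fixes the common weight as the reciprocal of the
      number of points. It is therefore positive, and the bound on the least weight becomes a lower
      bound on that number.\<close>
    have card: "real (card F) * w p = 1" if "p \<in> F" for p
    proof -
      have "(\<Sum>q\<in>F. w q) = (\<Sum>q\<in>F. w p)" by (intro sum.cong refl) (use eq that in blast)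
      then show ?thesis using cubature_formula_sum_weights[OF cub K(1,5)] by simp
    qed
    have "0 < w p" if "p \<in> F" for p
    proof (rule ccontr)
      assume "\<not> 0 < w p"
      then have "real (card F) * w p \<le> 0" by (intro mult_nonneg_nonpos) auto
      then show False using card[OF that] by simp
    qed
    then have "positive_formula F w" by (simp add: positive_formula_def)
    then obtain p where p: "p \<in> F" "w p \<le> C / real t ^ (2 * CARD('n))"
      using least[OF t cub] by blast
    have "1 \<le> real (card F) * (C / real t ^ (2 * CARD('n)))"
      using card[OF p(1)] mult_left_mono[OF p(2), of "real (card F)"] by simp
    then show "1 / C * real t ^ (2 * CARD('n)) \<le> real (card F)"
      using C t by (simp add: field_simps)
  qed (use C in simp)
next
  fix x assume simple: "simple_polytope K" and "facet_functions K x"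
  then interpret facet_metric K x using assms by unfold_locales
  obtain C where C: "0 < C" "\<And>t F w q. 1 \<le> t \<Longrightarrow> cubature_formula K t F w \<Longrightarrow> positive_formula F w \<Longrightarrow>
      F \<subseteq> K \<Longrightarrow> q \<in> K \<Longrightarrow> \<exists>p\<in>F. path_dist K x q p \<le> C / real t"
    using cubature_net[OF simple] by blast
  show "\<exists>C>0. \<forall>t\<ge>1. \<forall>F w. cubature_formula K t F w \<and>
      (positive_formula F w \<and> interior_formula K F \<or> positive_formula F w \<and> boundary_formula K F) \<longrightarrow>
      epsilon_net K x (C / real t) F"
  proof (intro exI[of _ C] conjI C(1) allI impI)
    fix t F w
    assume t: "1 \<le> t" and *: "cubature_formula K t F w \<and>
      (positive_formula F w \<and> interior_formula K F \<or> positive_formula F w \<and> boundary_formula K F)"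
    then have "F \<subseteq> K"
      using interior_subset[of K] by (auto simp: interior_formula_def boundary_formula_def)
    then show "epsilon_net K x (C / real t) F"
      unfolding epsilon_net_def using C(2)[OF t] * by blast
  qed
qed

end
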